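(* Let $\Gamma=(\gamma^i)_{i\in I}$ and $\Upsilon=(\upsilon^j)_{j\in J}$ be two disjoint homologically trivial multi-geodesics of the flat torus $\mathbb{T}^3=\mathbb{R}^3/\mathbb{Z}^3$. Then $$\mathrm{lk}(\Gamma,\Upsilon)=\sum_{i\in I,\,j\in J}\det\left([\gamma^i],[\upsilon^j],\frac{\beta^{i,j}}{\|\beta^{i,j}\|}\right)\frac{1-2\lfloor(\nu^{i,j}\cdot\beta^{i,j})\rfloor}{2\|\beta^{i,j}\|},$$ where $\beta^{i,j}=\beta^{[\gamma^i],[\upsilon^j]}$, $\nu^{i,j}=\gamma^i(0)-\upsilon^j(0)$ is the difference of the two origins, and for pairs with $[\gamma^i],[\upsilon^j]$ collinear the corresponding term is $0$.
   Context: A curve is an embedding of the oriented circle, a multi-curve a finite collection of pairwise disjoint curves, a multi-geodesic a multi-curve consisting of closed geodesics. Each closed geodesic $\gamma$ of $\mathbb{T}^3$ is parametrized (and oriented) as $t\mapsto t[\gamma]+\gamma(0)\bmod\mathbb{Z}^3$, $t\in[0,1]$, where $[\gamma]\in\mathbb{Z}^3$ is its constant velocity vector, identified with its homology class, and $\gamma(0)\in\mathbb{T}^3$ is a chosen point on it (its origin). A multi-geodesic $(\gamma^i)$ is homologically trivial iff $\sum_i[\gamma^i]=0$. For disjoint homologically trivial multi-curves, $\mathrm{lk}(\Gamma,\Upsilon)$ is the algebraic intersection number of $\Upsilon$ with any oriented surface bounded by $\Gamma$ (with the standard orientation of $\mathbb{T}^3$). For non-collinear $u,v\in\mathbb{Z}^3$,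 $\beta^{u,v}\in\mathbb{Z}^3$ is the unique nonzero vector with $\beta^{u,v}\perp\mathrm{span}(u,v)$, $\det(u,v,\beta^{u,v})>0$, and of minimal Euclidean norm among such vectors. $(a\cdot b)$ is the Euclidean scalar product, $\|\cdot\|$ the Euclidean norm, and $\lfloor\alpha\rfloor$ denotes the unique representative in $[0,1)$ of $\alpha\bmod\mathbb{Z}$ (well defined here since $\nu^{i,j}\in\mathbb{T}^3$ and $\beta^{i,j}\in\mathbb{Z}^3$). *)

theory Defs
  imports "HOL-Analysis.Analysis"
begin

text \<open>Points of the flat torus T^3 = R^3/Z^3 are represented by lifts in R^3 (type real^3);
  integer vectors (homology classes) have type int^3.\<close>

definition rvec :: "int^3 \<Rightarrow> real^3" where
  "rvec v = (\<chi> i. real_of_int (v $ i))"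

definition int_vec :: "real^3 \<Rightarrow> bool" where
  "int_vec k \<longleftrightarrow> (\<forall>i. k $ i \<in> \<int>)"

definition modeq :: "real^3 \<Rightarrow> real^3 \<Rightarrow> bool" where
  "modeq x y \<longleftrightarrow> int_vec (x - y)"

text \<open>det(u,v,w): determinant of the 3x3 matrix with columns u, v, w
  (we write rows; the determinant is invariant under transposition).\<close>
definition det3 :: "real^3 \<Rightarrow> real^3 \<Rightarrow> real^3 \<Rightarrow> real" where
  "det3 u v w = det (\<chi> i j. if i = 1 then u $ j else if i = 2 then v $ j else w $ j :: real^3^3)"

text \<open>A closed geodesic is given by its class c in Z^3 and its origin p; it is the curve
  t \<mapsto> t c + p mod Z^3, t in [0,1]. It is an embedded circle iff c is nonzero and primitive.\<close>
definition primitive :: "int^3 \<Rightarrow> bool" where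
  "primitive c \<longleftrightarrow> c \<noteq> 0 \<and> (\<forall>d::int. (\<forall>i. d dvd c $ i) \<longrightarrow> \<bar>d\<bar> = 1)"

text \<open>The (Z^3-invariant preimage in R^3 of the) point set of the geodesic.\<close>
definition geod_pts :: "int^3 \<Rightarrow> real^3 \<Rightarrow> (real^3) set" where
  "geod_pts c p = {y. \<exists>t\<in>{0..1}. modeq y (p + t *\<^sub>R rvec c)}"

definition multi_geodesic :: "'i set \<Rightarrow> ('i \<Rightarrow> int^3) \<Rightarrow> ('i \<Rightarrow> real^3) \<Rightarrow> bool" where
  "multi_geodesic I c p \<longleftrightarrow> finite I \<and> (\<forall>i\<in>I. primitive (c i)) \<and>
     (\<forall>i\<in>I. \<forall>i'\<in>I. i \<noteq> i' \<longrightarrow> geod_pts (c i) (p i) \<inter> geod_pts (c i') (p i') = {})"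

definition homologically_trivial :: "'i set \<Rightarrow> ('i \<Rightarrow> int^3) \<Rightarrow> bool" where
  "homologically_trivial I c \<longleftrightarrow> (\<Sum>i\<in>I. c i) = 0"

definition disjoint_multi :: "'i set \<Rightarrow> ('i \<Rightarrow> int^3) \<Rightarrow> ('i \<Rightarrow> real^3) \<Rightarrow>
    'j set \<Rightarrow> ('j \<Rightarrow> int^3) \<Rightarrow> ('j \<Rightarrow> real^3) \<Rightarrow> bool" where
  "disjoint_multi I c p J d q \<longleftrightarrow>
     (\<forall>i\<in>I. \<forall>j\<in>J. geod_pts (c i) (p i) \<inter> geod_pts (d j) (q j) = {})"

definition beta :: "int^3 \<Rightarrow> int^3 \<Rightarrow> int^3" where
  "beta u v = (THE b. b \<noteq> 0 \<and> rvec b \<bullet> rvec u = 0 \<and> rvec b \<bullet> rvec v = 0 \<and>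
       det3 (rvec u) (rvec v) (rvec b) > 0 \<and>
       (\<forall>b'. b' \<noteq> 0 \<and> rvec b' \<bullet> rvec u = 0 \<and> rvec b' \<bullet> rvec v = 0 \<and>
              det3 (rvec u) (rvec v) (rvec b') > 0 \<longrightarrow> norm (rvec b) \<le> norm (rvec b')))"

definition std_simplex :: "(real^2) set" where
  "std_simplex = {x. 0 \<le> x $ 1 \<and> 0 \<le> x $ 2 \<and> x $ 1 + x $ 2 \<le> 1}"

definition std_simplex_int :: "(real^2) set" where
  "std_simplex_int = {x. 0 < x $ 1 \<and> 0 < x $ 2 \<and> x $ 1 + x $ 2 < 1}"

definition pt2 :: "real \<Rightarrow> real \<Rightarrow> real^2" where
  "pt2 a b = (\<chi> i. if i = 1 then a else b)"

definition d1 :: "(real^2 \<Rightarrow> real^3) \<Rightarrow> real^2 \<Rightarrow> real^3" where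
  "d1 \<sigma> x = frechet_derivative \<sigma> (at x) (axis 1 1)"

definition d2 :: "(real^2 \<Rightarrow> real^3) \<Rightarrow> real^2 \<Rightarrow> real^3" where
  "d2 \<sigma> x = frechet_derivative \<sigma> (at x) (axis 2 1)"

text \<open>C^1 singular 2-simplex in T^3 (given through a lift to R^3; every map of the simplex lifts).\<close>
definition C1_simplex :: "(real^2 \<Rightarrow> real^3) \<Rightarrow> bool" where
  "C1_simplex \<sigma> \<longleftrightarrow> (\<exists>U. open U \<and> std_simplex \<subseteq> U \<and> (\<forall>x\<in>U. \<sigma> differentiable (at x)) \<and>
      continuous_on U (d1 \<sigma>) \<and> continuous_on U (d2 \<sigma>))"

definition line_int :: "(real^3 \<Rightarrow> real^3) \<Rightarrow> (real \<Rightarrow> real^3) \<Rightarrow> real" where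
  "line_int F g = integral {0..1} (\<lambda>t. F (g t) \<bullet> vector_derivative g (at t))"

definition boundary_int :: "(real^3 \<Rightarrow> real^3) \<Rightarrow> (real^2 \<Rightarrow> real^3) \<Rightarrow> real" where
  "boundary_int F \<sigma> =
     line_int F (\<lambda>t. \<sigma> (pt2 t 0)) + line_int F (\<lambda>t. \<sigma> (pt2 (1 - t) t)) +
     line_int F (\<lambda>t. \<sigma> (pt2 0 (1 - t)))"

definition periodic3 :: "(real^3 \<Rightarrow> real^3) \<Rightarrow> bool" where
  "periodic3 F \<longleftrightarrow> (\<forall>x k. int_vec k \<longrightarrow> F (x + k) = F x)"

text \<open>A 2-chain S (finite integer combination of C^1 singular simplices of T^3) bounds the
  multi-geodesic (c,p) indexed by I: the boundary of S equals the multi-curve as 1-currents,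
  i.e. they have the same integral against every continuous 1-form on T^3.\<close>
definition bounds :: "(int \<times> (real^2 \<Rightarrow> real^3)) list \<Rightarrow> 'i set \<Rightarrow> ('i \<Rightarrow> int^3) \<Rightarrow>
    ('i \<Rightarrow> real^3) \<Rightarrow> bool" where
  "bounds S I c p \<longleftrightarrow> (\<forall>(n, \<sigma>)\<in>set S. C1_simplex \<sigma>) \<and>
     (\<forall>F. continuous_on UNIV F \<and> periodic3 F \<longrightarrow>
        (\<Sum>(n, \<sigma>)\<leftarrow>S. real_of_int n * boundary_int F \<sigma>) =
        (\<Sum>i\<in>I. line_int F (\<lambda>t. p i + t *\<^sub>R rvec (c i))))"

definition ipts :: "(real^2 \<Rightarrow> real^3) \<Rightarrow> int^3 \<Rightarrow> real^3 \<Rightarrow> ((real^2) \<times> real) set" where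
  "ipts \<sigma> d q = {(x, t). x \<in> std_simplex \<and> t \<in> {0..<1} \<and> modeq (\<sigma> x) (q + t *\<^sub>R rvec d)}"

definition transverse_simplex :: "(real^2 \<Rightarrow> real^3) \<Rightarrow> int^3 \<Rightarrow> real^3 \<Rightarrow> bool" where
  "transverse_simplex \<sigma> d q \<longleftrightarrow> finite (ipts \<sigma> d q) \<and>
     (\<forall>(x, t)\<in>ipts \<sigma> d q. x \<in> std_simplex_int \<and> det3 (d1 \<sigma> x) (d2 \<sigma> x) (rvec d) \<noteq> 0)"

definition transverse :: "(int \<times> (real^2 \<Rightarrow> real^3)) list \<Rightarrow> 'j set \<Rightarrow> ('j \<Rightarrow> int^3) \<Rightarrow>
    ('j \<Rightarrow> real^3) \<Rightarrow> bool" where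
  "transverse S J d q \<longleftrightarrow> (\<forall>(n, \<sigma>)\<in>set S. \<forall>j\<in>J. transverse_simplex \<sigma> (d j) (q j))"

definition int_simplex :: "(real^2 \<Rightarrow> real^3) \<Rightarrow> int^3 \<Rightarrow> real^3 \<Rightarrow> int" where
  "int_simplex \<sigma> d q = (\<Sum>(x, t)\<in>ipts \<sigma> d q. (if det3 (d1 \<sigma> x) (d2 \<sigma> x) (rvec d) > 0 then 1 else -1))"

definition intersection_number :: "(int \<times> (real^2 \<Rightarrow> real^3)) list \<Rightarrow> 'j set \<Rightarrow>
    ('j \<Rightarrow> int^3) \<Rightarrow> ('j \<Rightarrow> real^3) \<Rightarrow> int" where
  "intersection_number S J d q = (\<Sum>(n, \<sigma>)\<leftarrow>S. n * (\<Sum>j\<in>J. int_simplex \<sigma> (d j) (q j)))"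

end

theory Submission
  imports Defs "HOL-Library.Periodic_Fun"
begin

text \<open>
  For each \<open>j\<close> complete \<open>d\<^sub>j\<close> to integer vectors \<open>a, b, e\<close> with \<open>a \<times> b = d\<^sub>j\<close> and \<open>e \<bullet> d\<^sub>j = 1\<close>; then
  \<open>X = a \<bullet> (P - q\<^sub>j)\<close> and \<open>Y = b \<bullet> (P - q\<^sub>j)\<close> are transverse coordinates in which the \<open>j\<close>-th geodesic is
  \<open>X, Y \<in> \<int>\<close>. Let \<open>B\<close> be a mollified sawtooth and \<open>\<rho> = B' + 1\<close> the corresponding periodic bump. The
  1-form \<open>\<alpha>\<^sub>j = B(X) dY - \<rho>(X) B(Y) dX\<close> lives on the torus and satisfies \<open>d\<alpha>\<^sub>j = (\<rho>(X) \<rho>(Y) - 1) dX \<and> dY\<close>.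
  Integrate \<open>\<Sum>\<^sub>j \<alpha>\<^sub>j\<close> over the boundary of \<open>S\<close>. By Stokes the terms \<open>\<rho>(X) \<rho>(Y) dX \<and> dY\<close> count the signed
  intersection points as soon as the bump is narrow, and the terms \<open>dX \<and> dY\<close> cancel because
  \<open>\<Sum>\<^sub>j d\<^sub>j = 0\<close>. On the other side the integral of \<open>\<alpha>\<^sub>j\<close> along a closed geodesic reduces, by the distribution
  relation of the sawtooth, to the value \<open>g (1/2 - frac (\<nu> \<bullet> \<beta>))\<close>, where \<open>[\<gamma>\<^sup>i] \<times> [\<upsilon>\<^sup>j] = g \<beta>\<close>.
\<close>

section \<open>Integer vectors and the primitive normal vector\<close>

text \<open>The form telescopes two one-dimensional corrections: B(X) dY has differential (\<rho>(X)
  - 1) dX \<and> dY, the second term has \<rho>(X) (\<rho>(Y) - 1) dX \<and> dY. With the exact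
  sawtooth and the Dirac comb, \<alpha> would be a primitive of the Poincare dual of the geodesic
  minus a constant form. That constant must be subtracted, since the dual of a single closed
  geodesic is not exact on the torus; this is why the forms are summed over j. The hypothesis
  \<open>bounds\<close> tests against continuous fields only, so the comb has to be mollified. Each
  simplex and each pair of geodesics then gives an identity that is exact below its own positive
  threshold for \<epsilon>, and finitely many thresholds have a common lower bound. The simplices
  are merely C1 and \<rho> is merely continuous, so Stokes' theorem rests on a Green formula free of
  second derivatives.\<close>

lemma det3_eq: "det3 u v w = cross3 u v \<bullet> w"
  by (simp add: det3_def det_3 cross3_simps)

lemma rvec_simps [simp]:
  "rvec 0 = 0" "rvec (u + v) = rvec u + rvec v"
  by (simp_all add: rvec_def vec_eq_iff)

lemma rvec_sum: "rvec (\<Sum>i\<in>A. f i) = (\<Sum>i\<in>A. rvec (f i))"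
  by (induction A rule: infinite_finite_induct) auto

lemma rvec_eq_iff: "rvec u = rvec v \<longleftrightarrow> u = v"
  by (auto simp: rvec_def vec_eq_iff)

lemma int_vec_rvec [simp]: "int_vec (rvec u)"
  by (simp add: int_vec_def rvec_def)

lemma int_vecE:
  assumes "int_vec x" obtains u where "x = rvec u"
proof
  show "x = rvec (\<chi> i. \<lfloor>x $ i\<rfloor>)"
    using assms by (auto simp: int_vec_def rvec_def vec_eq_iff elim!: Ints_cases)
qed

lemma int_vec_add [intro]: "int_vec x \<Longrightarrow> int_vec y \<Longrightarrow> int_vec (x + y)"
  and int_vec_diff [intro]: "int_vec x \<Longrightarrow> int_vec y \<Longrightarrow> int_vec (x - y)"
  and int_vec_scaleR [intro]: "r \<in> \<int> \<Longrightarrow> int_vec x \<Longrightarrow> int_vec (r *\<^sub>R x)"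
  by (simp_all add: int_vec_def)

lemma int_vec_cross [intro]: "int_vec x \<Longrightarrow> int_vec y \<Longrightarrow> int_vec (cross3 x y)"
  by (auto simp: int_vec_def cross_components forall_3)

lemma int_vec_inner [intro]: "int_vec x \<Longrightarrow> int_vec y \<Longrightarrow> x \<bullet> y \<in> \<int>"
  by (auto simp: int_vec_def inner_vec_def sum_3 forall_3)

lemma inner_rvec_Ints [simp]: "rvec u \<bullet> rvec v \<in> \<int>"
  by (simp add: int_vec_inner)

text \<open>The three cross products form the dual basis of a, b, e. Both expansions are polynomial
  identities for an arbitrary triple, with its determinant as a factor of w. For integer a, b, e the
  dual basis is integral as well, so pairings detect integrality.\<close>

lemma unimodular_expansion:
  fixes a b e w :: "real^3"
  assumes "cross3 a b \<bullet> e = 1"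
  shows "w = (w \<bullet> a) *\<^sub>R cross3 b e + (w \<bullet> b) *\<^sub>R cross3 e a + (w \<bullet> e) *\<^sub>R cross3 a b"
    and "w = (w \<bullet> cross3 b e) *\<^sub>R a + (w \<bullet> cross3 e a) *\<^sub>R b + (w \<bullet> cross3 a b) *\<^sub>R e"
proof -
  have "(cross3 a b \<bullet> e) *\<^sub>R w = (w \<bullet> a) *\<^sub>R cross3 b e + (w \<bullet> b) *\<^sub>R cross3 e a + (w \<bullet> e) *\<^sub>R cross3 a b"
    by (simp add: vec_eq_iff forall_3 cross_components inner_vec_def sum_3) algebra
  thus "w = (w \<bullet> a) *\<^sub>R cross3 b e + (w \<bullet> b) *\<^sub>R cross3 e a + (w \<bullet> e) *\<^sub>R cross3 a b"
    using assms by simp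
  have "(cross3 a b \<bullet> e) *\<^sub>R w = (w \<bullet> cross3 b e) *\<^sub>R a + (w \<bullet> cross3 e a) *\<^sub>R b + (w \<bullet> cross3 a b) *\<^sub>R e"
    by (simp add: vec_eq_iff forall_3 cross_components inner_vec_def sum_3) algebra
  thus "w = (w \<bullet> cross3 b e) *\<^sub>R a + (w \<bullet> cross3 e a) *\<^sub>R b + (w \<bullet> cross3 a b) *\<^sub>R e"
    using assms by simp
qed

lemma primitive_bezout:
  assumes "primitive d"
  obtains e where "rvec d \<bullet> rvec e = 1"
proof -
  define g where "g = gcd (d $ 1) (gcd (d $ 2) (d $ 3))"
  have "\<forall>i. g dvd d $ i"
    unfolding forall_3 g_def by (meson dvd_trans gcd_dvd1 gcd_dvd2)
  hence "\<bar>g\<bar> = 1"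
    using assms unfolding primitive_def by blast
  hence g: "g = 1"
    by (simp add: g_def)
  obtain r s where rs: "r * (d $ 2) + s * (d $ 3) = gcd (d $ 2) (d $ 3)"
    using bezout_int by blast
  obtain x y where xy: "x * (d $ 1) + y * (gcd (d $ 2) (d $ 3)) = g"
    unfolding g_def using bezout_int by blast
  have "d $ 1 * x + d $ 2 * (y * r) + d $ 3 * (y * s) = 1"
    using xy rs g by algebra
  hence "real_of_int (d $ 1 * x + d $ 2 * (y * r) + d $ 3 * (y * s)) = 1"
    by simp
  hence "rvec d \<bullet> rvec (vector [x, y * r, y * s]) = 1"
    by (simp add: rvec_def inner_vec_def sum_3)
  thus ?thesis using that by blast
qed

lemma int_cross_decomposition:
  "\<exists>a b. cross3 (rvec a) (rvec b) = rvec d"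
proof (cases "gcd (d $ 1) (d $ 2) = 0")
  case False
  define g where "g = gcd (d $ 1) (d $ 2)"
  have g0: "g \<noteq> 0" using False by (simp add: g_def)
  obtain r s where rs: "r * (d $ 1) + s * (d $ 2) = g"
    using bezout_int unfolding g_def by blast
  obtain u where u: "d $ 1 = g * u" by (metis dvdE g_def gcd_dvd1)
  obtain v where v: "d $ 2 = g * v" by (metis dvdE g_def gcd_dvd2)
  have "g * (r * u + s * v) = r * (d $ 1) + s * (d $ 2)"
    by (simp add: u v distrib_left mult.left_commute)
  hence "g * (r * u + s * v) = g * 1" using rs by simp
  hence ruv: "r * u + s * v = 1" using g0 by simp
  hence "d $ 3 = d $ 3 * (r * u + s * v)" by simp
  hence d3: "real_of_int (d $ 3) = d $ 3 * (r * u + s * v)" by (metis of_int_mult)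
  \<comment> \<open>The first factor is orthogonal to d. In the product, g restores the first two
    components, and the Bezout relation r u + s v = 1 produces the third.\<close>
  have "cross3 (rvec (vector [- v, u, 0])) (rvec (vector [- r * d $ 3, - s * d $ 3, g])) = rvec d"
    using d3 u v by (simp add: vec_eq_iff forall_3 cross_components rvec_def algebra_simps)
  thus ?thesis by blast
next
  case True
  have "cross3 (rvec (vector [d $ 3, 0, 0])) (rvec (vector [0, 1, 0])) = rvec d"
    using True by (simp add: vec_eq_iff forall_3 cross_components rvec_def)
  thus ?thesis by blast
qed

lemma primitive_basis:
  assumes "primitive d"
  obtains a b e where "cross3 (rvec a) (rvec b) = rvec d" "rvec d \<bullet> rvec e = 1"
  using int_cross_decomposition[of d] primitive_bezout[OF assms] that by metis

text \<open>A vector is integral iff its pairings with a, b and e are integers. The pairings with a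
  and b do not see multiples of d, and the pairing with e reads off the time t modulo 1.\<close>

lemma modeq_line_iff:
  assumes ab: "cross3 (rvec a) (rvec b) = rvec d" and e: "rvec d \<bullet> rvec e = 1"
  shows "modeq P (q + t *\<^sub>R rvec d) \<longleftrightarrow>
    rvec a \<bullet> (P - q) \<in> \<int> \<and> rvec b \<bullet> (P - q) \<in> \<int> \<and> (P - q) \<bullet> rvec e - t \<in> \<int>"
proof
  have orth: "rvec a \<bullet> rvec d = 0" "rvec b \<bullet> rvec d = 0"
    by (simp_all add: ab[symmetric] dot_cross_self)
  assume "modeq P (q + t *\<^sub>R rvec d)"
  hence *: "int_vec (P - q - t *\<^sub>R rvec d)" by (simp add: modeq_def algebra_simps)
  have "rvec a \<bullet> (P - q - t *\<^sub>R rvec d) \<in> \<int>" "rvec b \<bullet> (P - q - t *\<^sub>R rvec d) \<in> \<int>"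
    "(P - q - t *\<^sub>R rvec d) \<bullet> rvec e \<in> \<int>"
    using * by auto
  thus "rvec a \<bullet> (P - q) \<in> \<int> \<and> rvec b \<bullet> (P - q) \<in> \<int> \<and> (P - q) \<bullet> rvec e - t \<in> \<int>"
    using orth e by (simp add: inner_diff_right inner_diff_left)
next
  assume *: "rvec a \<bullet> (P - q) \<in> \<int> \<and> rvec b \<bullet> (P - q) \<in> \<int> \<and> (P - q) \<bullet> rvec e - t \<in> \<int>"
  have "P - q - t *\<^sub>R rvec d = ((P - q) \<bullet> rvec a) *\<^sub>R cross3 (rvec b) (rvec e)
      + ((P - q) \<bullet> rvec b) *\<^sub>R cross3 (rvec e) (rvec a) + ((P - q) \<bullet> rvec e - t) *\<^sub>R rvec d"
    by (subst (1) unimodular_expansion(1)[of "rvec a" "rvec b" "rvec e" "P - q"])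
      (simp_all add: ab e scaleR_left_diff_distrib)
  also have "int_vec \<dots>"
    using * by (intro int_vec_add int_vec_scaleR int_vec_cross) (auto simp: inner_commute)
  finally show "modeq P (q + t *\<^sub>R rvec d)" by (simp add: modeq_def algebra_simps)
qed

lemma cross3_of_projections:
  assumes "cross3 a b = d"
  shows "cross3 c d = (b \<bullet> c) *\<^sub>R a - (a \<bullet> c) *\<^sub>R b"
  using assms by (auto simp: Lagrange inner_commute)

text \<open>Every competitor in the definition of \<open>beta\<close> is an integer multiple of the
  generator; positivity of the determinant forces the factor to be at least 1, so the generator is
  the unique shortest one.\<close>

lemma beta_eqI:
  assumes "b0 \<noteq> 0" "rvec b0 \<bullet> rvec u = 0" "rvec b0 \<bullet> rvec v = 0"
    and "det3 (rvec u) (rvec v) (rvec b0) > 0"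
    and gen: "\<And>b'. rvec b' \<bullet> rvec u = 0 \<Longrightarrow> rvec b' \<bullet> rvec v = 0 \<Longrightarrow> \<exists>k::int. rvec b' = k *\<^sub>R rvec b0"
  shows "beta u v = b0"
  unfolding beta_def
proof (rule the_equality, goal_cases)
  have mult: "\<exists>k::int. (1::int) \<le> k \<and> rvec b' = k *\<^sub>R rvec b0"
    if b': "b' \<noteq> 0" "rvec b' \<bullet> rvec u = 0" "rvec b' \<bullet> rvec v = 0"
      "det3 (rvec u) (rvec v) (rvec b') > 0" for b'
  proof -
    obtain k :: int where k: "rvec b' = k *\<^sub>R rvec b0" using gen b' by blast
    have "real_of_int k * det3 (rvec u) (rvec v) (rvec b0) > 0"
      using b'(4) by (simp add: k det3_eq)
    hence "k > 0" using assms(4) by (simp add: zero_less_mult_iff)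
    thus ?thesis using k by (intro exI[of _ k]) auto
  qed
  have le: "norm (rvec b0) \<le> norm (rvec b')" if "(1::int) \<le> k" "rvec b' = real_of_int k *\<^sub>R rvec b0" for b' k
    using that mult_right_mono[of 1 "real_of_int k" "norm (rvec b0)"] by simp
  {
    case 1
    show ?case using assms(1-4) mult le by metis
  next
    case (2 b)
    then obtain k where k: "(1::int) \<le> k" "rvec b = real_of_int k *\<^sub>R rvec b0" using mult by metis
    have "norm (rvec b) \<le> norm (rvec b0)" using 2 assms(1-4) by metis
    moreover have "norm (rvec b0) > 0" using assms(1) rvec_eq_iff[of b0 0] by simp
    ultimately have "real_of_int k * norm (rvec b0) \<le> 1 * norm (rvec b0)" using k by simp
    hence "k \<le> 1" using \<open>norm (rvec b0) > 0\<close> by (simp only: mult_le_cancel_right) auto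
    hence "k = 1" using k by simp
    thus ?case using k rvec_eq_iff by simp
  }
qed

text \<open>The numbers m and n are the slopes of X and Y along c, and Lagrange's identity gives c
  \<times> d = n a - m b. Dividing by the gcd leaves a generator of the integer vectors orthogonal
  to c and d, because a and b belong to a basis of the integer lattice.\<close>

lemma beta_formula:
  fixes m n m' n' g :: int
  assumes ab: "cross3 (rvec a) (rvec b) = rvec d" and e: "rvec d \<bullet> rvec e = 1"
    and m: "rvec a \<bullet> rvec c = m" and n: "rvec b \<bullet> rvec c = n"
    and g: "m = g * m'" "n = g * n'" "g > 0" "coprime m' n'"
  shows "rvec (beta c d) = n' *\<^sub>R rvec a - m' *\<^sub>R rvec b"
    and "cross3 (rvec c) (rvec d) = g *\<^sub>R rvec (beta c d)"
    and "rvec (beta c d) \<noteq> 0"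
proof -
  define w where "w = real_of_int n' *\<^sub>R rvec a - real_of_int m' *\<^sub>R rvec b"
  have cd: "cross3 (rvec c) (rvec d) = real_of_int g *\<^sub>R w"
    using cross3_of_projections[OF ab, of "rvec c"] g m n by (simp add: w_def algebra_simps)
  have "int_vec w" unfolding w_def by (intro int_vec_diff int_vec_scaleR) auto
  then obtain b0 where b0: "w = rvec b0" by (rule int_vecE)
  have orth: "rvec a \<bullet> rvec d = 0" "rvec b \<bullet> rvec d = 0"
    by (simp_all add: ab[symmetric] dot_cross_self)
  have wd: "w \<bullet> rvec d = 0" by (simp add: w_def inner_diff_left orth)
  have wc: "w \<bullet> rvec c = 0" using m n g by (simp add: w_def inner_diff_left)
  have dual: "rvec a \<bullet> cross3 (rvec b) (rvec e) = 1" "rvec b \<bullet> cross3 (rvec b) (rvec e) = 0"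
     "rvec b \<bullet> cross3 (rvec e) (rvec a) = 1" "rvec a \<bullet> cross3 (rvec e) (rvec a) = 0"
    using e ab cross_triple[of "rvec a" "rvec b" "rvec e"] cross_triple[of "rvec b" "rvec e" "rvec a"]
    by (simp_all add: dot_cross_self inner_commute)
  have w0: "w \<noteq> 0"
  proof
    assume "w = 0"
    hence "w \<bullet> cross3 (rvec b) (rvec e) = 0" "w \<bullet> cross3 (rvec e) (rvec a) = 0" by auto
    hence "n' = 0" "m' = 0" using dual by (simp_all add: w_def inner_diff_right inner_diff_left)
    thus False using g by simp
  qed
  have "beta c d = b0"
  proof (rule beta_eqI)
    show "b0 \<noteq> 0" using w0 b0 by auto
    show "rvec b0 \<bullet> rvec c = 0" "rvec b0 \<bullet> rvec d = 0" using wc wd b0 by auto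
    show "det3 (rvec c) (rvec d) (rvec b0) > 0" using g w0 by (simp add: det3_eq cd b0[symmetric])
  next
    fix b' assume *: "rvec b' \<bullet> rvec c = 0" "rvec b' \<bullet> rvec d = 0"
    have "rvec b' \<bullet> cross3 (rvec b) (rvec e) \<in> \<int>" "rvec b' \<bullet> cross3 (rvec e) (rvec a) \<in> \<int>"
      by (intro int_vec_inner int_vec_cross int_vec_rvec)+
    then obtain k l :: int where kl: "rvec b' \<bullet> cross3 (rvec b) (rvec e) = k" "rvec b' \<bullet> cross3 (rvec e) (rvec a) = l"
      by (meson Ints_cases)
    \<comment> \<open>The third coefficient of the expansion is the pairing with d, which is
      zero.\<close>
    have b': "rvec b' = k *\<^sub>R rvec a + l *\<^sub>R rvec b"
      by (subst unimodular_expansion(2)[of "rvec a" "rvec b" "rvec e" "rvec b'"])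
        (simp_all add: kl ab e *)
    have "real_of_int k * m + l * n = 0"
      using *(1) m n by (simp add: b' inner_add_left)
    hence "real_of_int (k * m + l * n) = real_of_int 0" by simp
    hence "k * m + l * n = 0" by (simp only: of_int_eq_iff)
    hence "g * (k * m' + l * n') = g * 0" using g by algebra
    hence eq: "k * m' = - (l * n')" using g by simp
    obtain x y where xy: "x * m' + y * n' = 1"
      using bezout_int[of m' n'] g(4) by auto
    \<comment> \<open>Multiplying x m' + y n' = 1 by k and by l and using k m' = - l n' leaves this
      common multiplier.\<close>
    define r where "r = k * y - l * x"
    have r: "k = n' * r" "l = - (m' * r)" using xy eq unfolding r_def by algebra+
    thus "\<exists>k::int. rvec b' = k *\<^sub>R rvec b0"
      using r by (intro exI[of _ r]) (simp add: b' b0[symmetric] w_def algebra_simps)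
  qed
  thus "rvec (beta c d) = n' *\<^sub>R rvec a - m' *\<^sub>R rvec b" using b0 w_def by simp
  thus "cross3 (rvec c) (rvec d) = g *\<^sub>R rvec (beta c d)" "rvec (beta c d) \<noteq> 0"
    using cd w0 by (simp_all add: w_def)
qed

section \<open>Mollified sawtooth functions\<close>

lemma continuous_antiderivative:
  fixes f :: "real \<Rightarrow> real"
  assumes "continuous_on UNIV f"
  obtains G where "\<And>x. (G has_real_derivative f x) (at x)" "G 0 = 0"
proof
  define G where "G u = (LBINT y=0..u. f y)" for u :: real
  show "G 0 = 0" by (simp add: G_def zero_ereal_def[symmetric])
  show "(G has_real_derivative f x) (at x)" for x
  proof -
    \<comment> \<open>The margin 1 puts x in the interior, so a derivative within the interval is a
      derivative at x.\<close>
    let ?a = "min x 0 - 1" and ?b = "max x 0 + 1"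
    have "(G has_vector_derivative f x) (at x within {?a..?b})"
      unfolding G_def zero_ereal_def
      by (rule interval_integral_FTC2) (auto intro: continuous_on_subset[OF assms])
    hence "(G has_vector_derivative f x) (at x within {?a<..<?b})"
      by (rule has_vector_derivative_within_subset) auto
    thus ?thesis
      by (subst (asm) at_within_open) (auto simp: has_real_derivative_iff_has_vector_derivative)
  qed
qed

lemma periodic_plus_of_int:
  fixes f :: "real \<Rightarrow> 'a"
  assumes "\<And>x. f (x + 1) = f x"
  shows "f (x + of_int k) = f x"
proof -
  interpret periodic_fun_simple' f by standard (rule assms)
  show ?thesis by (rule plus_of_int)
qed

text \<open>The bump \<open>\<rho>\<close> approximates the Dirac comb. Being even, it reproduces affine functions exactly under
  convolution, so no limit \<open>\<epsilon> \<rightarrow> 0\<close> is needed later.\<close>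
locale sawtooth =
  fixes \<epsilon> :: real and \<rho> B :: "real \<Rightarrow> real"
  assumes eps: "0 < \<epsilon>" "\<epsilon> < 1/4"
    and cont_bump: "continuous_on UNIV \<rho>"
    and periodic_bump: "\<rho> (x + 1) = \<rho> x"
    and deriv_saw: "(B has_real_derivative \<rho> x - 1) (at x)"
    and periodic_saw: "B (x + 1) = B x"
    and odd_saw: "B (- x) = - B x"
    and bump_far: "\<epsilon> \<le> frac x \<Longrightarrow> frac x \<le> 1 - \<epsilon> \<Longrightarrow> \<rho> x = 0"
    and saw_far: "\<epsilon> \<le> frac x \<Longrightarrow> frac x \<le> 1 - \<epsilon> \<Longrightarrow> B x = 1/2 - frac x"

lemma cos_2pi_le:
  assumes "0 \<le> \<epsilon>" "\<epsilon> \<le> frac x" "frac x \<le> 1 - \<epsilon>"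
  shows "cos (2 * pi * x) \<le> cos (2 * pi * \<epsilon>)"
proof -
  have "cos (2 * pi * x) = cos (2 * pi * frac x + of_int \<lfloor>x\<rfloor> * (2 * of_real pi))"
    by (rule arg_cong[of _ _ cos]) (simp add: frac_def algebra_simps)
  also have "\<dots> = cos (2 * pi * frac x)"
    by (rule cos.plus_of_int)
  also have "\<dots> \<le> cos (2 * pi * \<epsilon>)"
  proof (cases "frac x \<le> 1/2")
    case True
    show ?thesis
    proof (rule cos_monotone_0_pi_le)
      show "2 * pi * \<epsilon> \<le> 2 * pi * frac x"
        using assms by (intro mult_left_mono) auto
      show "2 * pi * frac x \<le> pi"
        using True mult_left_mono[of "frac x" "1/2" "2 * pi"] by simp
    qed (use assms in simp)
  next
    case False
    have "cos (2 * pi * frac x) = cos (2 * pi * (1 - frac x))"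
      by (simp add: right_diff_distrib cos_diff)
    also have "\<dots> \<le> cos (2 * pi * \<epsilon>)"
    proof (rule cos_monotone_0_pi_le)
      show "2 * pi * \<epsilon> \<le> 2 * pi * (1 - frac x)"
        using assms by (intro mult_left_mono) auto
      show "2 * pi * (1 - frac x) \<le> pi"
        using False mult_left_mono[of "1 - frac x" "1/2" "2 * pi"] by simp
    qed (use assms in simp)
    finally show ?thesis .
  qed
  finally show ?thesis .
qed

text \<open>The bump is a cosine cut off at height cos (2 \<pi> \<epsilon>): even, 1-periodic and
  supported within \<epsilon> of the integers. Its primitive F, divided by the mass M of one period,
  is a smoothed staircase; subtracting x makes it periodic.\<close>

lemma sawtooth_exists:
  assumes "0 < \<epsilon>" "\<epsilon> < 1/4"
  shows "\<exists>\<rho> B. sawtooth \<epsilon> \<rho> B"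
proof -
  define f where "f x = max 0 (cos (2 * pi * x) - cos (2 * pi * \<epsilon>))" for x
  have contf: "continuous_on UNIV f" unfolding f_def by (intro continuous_intros)
  obtain F where F: "\<And>x. (F has_real_derivative f x) (at x)" "F 0 = 0"
    using continuous_antiderivative[OF contf] by metis
  have f1: "f (x + 1) = f x" for x by (simp add: f_def distrib_left)
  have fm: "f (- x) = f x" for x by (simp add: f_def)
  have monoF: "F x \<le> F y" if "x \<le> y" for x y
  proof (rule DERIV_nonneg_imp_nondecreasing[OF that])
    show "\<exists>y. (F has_real_derivative y) (at z) \<and> 0 \<le> y" for z
      using F(1)[of z] by (auto simp: f_def intro!: exI[of _ "f z"])
  qed
  have "F 0 < F \<epsilon>"
  proof (rule DERIV_pos_imp_increasing_open[of 0 \<epsilon> F])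
    fix x assume "0 < x" "x < \<epsilon>"
    have "cos (2 * pi * \<epsilon>) < cos (2 * pi * x)"
    proof (rule cos_monotone_0_pi)
      show "2 * pi * x < 2 * pi * \<epsilon>"
        using \<open>x < \<epsilon>\<close> by (intro mult_strict_left_mono) auto
      show "2 * pi * \<epsilon> \<le> pi"
        using assms mult_left_mono[of \<epsilon> "1/2" "2 * pi"] by simp
    qed (use \<open>0 < x\<close> in simp)
    thus "\<exists>y. (F has_real_derivative y) (at x) \<and> 0 < y"
      using F(1)[of x] by (auto simp: f_def intro!: exI[of _ "f x"])
  next
    show "continuous_on {0..\<epsilon>} F"
      using F(1) by (meson DERIV_continuous_on has_field_derivative_at_within)
  qed (use assms in simp)
  define M where "M = F 1"
  have M: "M > 0" unfolding M_def using \<open>F 0 < F \<epsilon>\<close> F(2) monoF[of \<epsilon> 1] assms by simp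
  define B where "B x = F x / M - x" for x
  have const: "g x = g y" if "\<And>x. (g has_real_derivative 0) (at x)" for g :: "real \<Rightarrow> real" and x y
    using that DERIV_isconst_all by blast
  have F1: "F (x + 1) = F x + M" for x
  proof -
    have "F (x + 1) - F x = F (0 + 1) - F 0"
      by (rule const[of "\<lambda>x. F (x + 1) - F x"])
        (use F(1) f1 DERIV_shift[of F _ _ 1] in \<open>auto intro!: derivative_eq_intros\<close>)
    thus ?thesis by (simp add: M_def F(2))
  qed
  have Fm: "F (- x) = - F x" for x
  proof -
    have "F (- x) + F x = F (- 0) + F 0"
      by (rule const[of "\<lambda>x. F (- x) + F x"])
        (use F(1) fm DERIV_mirror[of F] in \<open>auto intro!: derivative_eq_intros\<close>)
    thus ?thesis by (simp add: F(2))
  qed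
  have f0: "f x = 0" if "\<epsilon> \<le> frac x" "frac x \<le> 1 - \<epsilon>" for x
    using cos_2pi_le[OF _ that] assms by (simp add: f_def)
  have B1: "B (x + 1) = B x" for x
    using M by (simp add: B_def F1 add_divide_distrib)
  have Bint: "B (x + of_int k) = B x" for x k
    using B1 by (rule periodic_plus_of_int)
  have Bfar: "B y = 1/2 - y" if "\<epsilon> \<le> y" "y \<le> 1 - \<epsilon>" for y
  proof -
    have "\<exists>c. \<forall>x\<in>{\<epsilon>..1-\<epsilon>}. F x = c"
    proof (rule has_field_derivative_zero_constant)
      fix x assume x: "x \<in> {\<epsilon>..1-\<epsilon>}"
      hence "frac x = x" using assms by (simp add: frac_eq)
      hence "f x = 0" using f0[of x] x by simp
      thus "(F has_field_derivative 0) (at x within {\<epsilon>..1-\<epsilon>})"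
        using F(1)[of x] by (simp add: has_field_derivative_at_within)
    qed simp
    hence "F y = F (1/2)" using that assms by auto
    \<comment> \<open>F is odd and gains M per period, so its constant value between two bumps is
      M/2. This is the 1/2 of the sawtooth.\<close>
    moreover have "F (1/2) = F (- (1/2)) + M" using F1[of "- (1/2)"] by simp
    hence "F (1/2) = M / 2" by (simp add: Fm)
    ultimately show ?thesis using M by (simp add: B_def)
  qed
  have "sawtooth \<epsilon> (\<lambda>x. f x / M) B"
  proof
    show "continuous_on UNIV (\<lambda>x. f x / M)" using M by (intro continuous_intros contf) auto
    show "f (x + 1) / M = f x / M" for x by (simp add: f1)
    show "(B has_real_derivative f x / M - 1) (at x)" for x
      unfolding B_def using F(1) M by (auto intro!: derivative_eq_intros)
    show "B (x + 1) = B x" for x by (rule B1)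
    show "B (- x) = - B x" for x by (simp add: B_def Fm)
    show "f x / M = 0" if "\<epsilon> \<le> frac x" "frac x \<le> 1 - \<epsilon>" for x using f0[OF that] by simp
    show "B x = 1/2 - frac x" if "\<epsilon> \<le> frac x" "frac x \<le> 1 - \<epsilon>" for x
      using Bfar[OF that] Bint[of "frac x" "\<lfloor>x\<rfloor>"] by (simp add: frac_def)
  qed (use assms in auto)
  thus ?thesis by blast
qed

section \<open>Integrals along closed geodesics\<close>

context sawtooth begin

lemma saw_plus_int: "B (x + of_int k) = B x"
  using periodic_saw by (rule periodic_plus_of_int)

lemma bump_plus_int: "\<rho> (x + of_int k) = \<rho> x"
  using periodic_bump by (rule periodic_plus_of_int)

lemma cont_saw: "continuous_on UNIV B"
  using deriv_saw by (meson DERIV_continuous_on has_field_derivative_at_within)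

text \<open>Differentiate the oddness of B.\<close>

lemma even_bump: "\<rho> (- x) = \<rho> x"
proof -
  have "((\<lambda>x. B (- x)) has_real_derivative - (\<rho> (- x) - 1)) (at x)"
    using deriv_saw[of "- x"] DERIV_mirror[of B] by simp
  moreover have "((\<lambda>x. B (- x)) has_real_derivative - (\<rho> x - 1)) (at x)"
    unfolding odd_saw using deriv_saw[of x] by (auto intro!: derivative_eq_intros)
  ultimately show ?thesis by (auto dest: DERIV_unique)
qed

lemma continuous_on_bump_saw [continuous_intros]:
  assumes "continuous_on S f"
  shows "continuous_on S (\<lambda>x. \<rho> (f x))" "continuous_on S (\<lambda>x. B (f x))"
  using assms cont_bump cont_saw by (auto intro: continuous_on_compose2)

lemma saw_affine:
  assumes "\<epsilon> + \<bar>y\<bar> \<le> frac \<theta>" "frac \<theta> \<le> 1 - \<epsilon> - \<bar>y\<bar>"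
  shows "B (\<theta> + y) = 1/2 - frac \<theta> - y"
proof -
  have "frac (\<theta> + y) = frac \<theta> + y"
    using assms eps frac_ge_0[of \<theta>] by (subst frac_unique_iff) (auto simp: frac_def)
  thus ?thesis using saw_far[of "\<theta> + y"] assms by simp
qed

lemma bump_supp:
  assumes "\<epsilon> \<le> \<bar>x\<bar>" "\<bar>x\<bar> \<le> 1/2"
  shows "\<rho> x = 0"
proof (cases "x \<ge> 0")
  case True
  hence "frac x = x" using assms by (simp add: frac_eq)
  thus ?thesis using bump_far[of x] assms eps True by simp
next
  case False
  hence "frac (- x) = - x" using assms by (simp add: frac_eq)
  thus ?thesis using bump_far[of "- x"] assms eps False even_bump by simp
qed

text \<open>B is odd, so its antiderivative H is even; comparing H at 1/2 and -1/2 shows that H is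
  1-periodic, that is, B has mean zero.\<close>

lemma integral_saw_multiple:
  fixes m :: int
  assumes "m \<noteq> 0"
  shows "integral {0..1} (\<lambda>t. B (x + t * m)) = 0"
proof -
  obtain H where H: "\<And>x. (H has_real_derivative B x) (at x)"
    using continuous_antiderivative[OF cont_saw] by metis
  have const: "g x = g y" if "\<And>x. (g has_real_derivative 0) (at x)" for g :: "real \<Rightarrow> real" and x y
    using that DERIV_isconst_all by blast
  have Hm: "H (- x) - H x = H (- 0) - H 0" for x
    by (rule const[of "\<lambda>x. H (- x) - H x"])
      (use H DERIV_mirror[of H] odd_saw in \<open>auto intro!: derivative_eq_intros\<close>)
  have "H (x + 1) - H x = H (- (1/2) + 1) - H (- (1/2))" for x
    by (rule const[of "\<lambda>x. H (x + 1) - H x"])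
      (use H periodic_saw DERIV_shift[of H _ _ 1] in \<open>auto intro!: derivative_eq_intros\<close>)
  hence "H (x + 1) = H x" for x
    using Hm[of "1/2"] by simp
  hence Hint: "H (x + of_int k) = H x" for x k by (rule periodic_plus_of_int)
  have "((\<lambda>t. B (x + t * m)) has_integral H (x + 1 * real_of_int m) / m - H (x + 0 * real_of_int m) / m) {0..1}"
    using assms
    by (intro fundamental_theorem_of_calculus[where f = "\<lambda>t. H (x + t * of_int m) / of_int m"])
      (auto intro!: derivative_eq_intros DERIV_chain2[OF H] simp: has_real_derivative_iff_has_vector_derivative[symmetric])
  thus ?thesis using Hint by (simp add: integral_unique)
qed

text \<open>The mass 1 is the increment of B(x) + x over one period; the first moment vanishes under
  the reflection of x to -x.\<close>

lemma integral_bump_affine: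
  "((\<lambda>x. \<rho> x * (c + s * x)) has_integral c) {- (1/2)..1/2}"
proof -
  have 1: "(\<rho> has_integral 1) {- (1/2)..1/2}"
  proof -
    have "(\<rho> has_integral (B (1/2) + 1/2) - (B (- (1/2)) + - (1/2))) {- (1/2)..1/2}"
      by (intro fundamental_theorem_of_calculus)
        (auto intro!: derivative_eq_intros has_field_derivative_at_within[OF deriv_saw]
          simp: has_real_derivative_iff_has_vector_derivative[symmetric])
    thus ?thesis using periodic_saw[of "- (1/2)"] by simp
  qed
  have int: "(\<lambda>x. \<rho> x * x) integrable_on {- (1/2)..1/2}"
    by (intro integrable_continuous_interval continuous_intros)
  have "integral {- (1/2)..1/2} (\<lambda>x. \<rho> x * x) = integral {- (1/2)..1/2} (\<lambda>x. \<rho> (- x) * (- x))"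
    using Henstock_Kurzweil_Integration.integral_reflect_real[of "1/2" "- (1/2)" "\<lambda>x. \<rho> x * x"] by simp
  hence "integral {- (1/2)..1/2} (\<lambda>x. \<rho> x * x) = 0"
    by (simp add: even_bump)
  hence 2: "((\<lambda>x. \<rho> x * x) has_integral 0) {- (1/2)..1/2}"
    using int by (metis integrable_integral)
  have "((\<lambda>x. c * \<rho> x + s * (\<rho> x * x)) has_integral c * 1 + s * 0) {- (1/2)..1/2}"
    by (intro has_integral_add has_integral_mult_right 1 2)
  thus ?thesis by (simp add: algebra_simps)
qed

text \<open>Where the bump is nonzero, the argument of B moves by at most \<epsilon> |s|, and B is
  affine at distance \<epsilon> from the integers; hence the margin \<epsilon> (1 + |s|). The bump
  then evaluates an affine function at its centre.\<close>

lemma integral_bump_saw_unit: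
  assumes "\<epsilon> * (1 + \<bar>s\<bar>) \<le> frac \<theta>" "frac \<theta> \<le> 1 - \<epsilon> * (1 + \<bar>s\<bar>)"
  shows "((\<lambda>x. \<rho> x * B (\<theta> + x * s)) has_integral 1/2 - frac \<theta>) {- (1/2)..1/2}"
proof (rule has_integral_eq[OF _ integral_bump_affine[of "1/2 - frac \<theta>" "- s"]])
  fix x :: real assume x: "x \<in> {- (1/2)..1/2}"
  show "\<rho> x * (1/2 - frac \<theta> + - s * x) = \<rho> x * B (\<theta> + x * s)"
  proof (cases "\<epsilon> \<le> \<bar>x\<bar>")
    case True
    hence "\<rho> x = 0" using x by (intro bump_supp) auto
    thus ?thesis by simp
  next
    case False
    hence "\<bar>x * s\<bar> \<le> \<epsilon> * \<bar>s\<bar>" by (simp add: abs_mult mult_right_mono)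
    hence "B (\<theta> + x * s) = 1/2 - frac \<theta> - x * s"
      using assms by (intro saw_affine) (auto simp: distrib_left)
    thus ?thesis by simp
  qed
qed

text \<open>In the variable z = x + t m the path runs through m unit periods with one bump each, and
  the bump at k samples B at the value of Y for which X = k.\<close>

lemma integral_bump_saw_sum:
  fixes x y :: real and m :: nat and n :: int
  assumes m: "m > 0"
    and far: "\<And>k. k < m \<Longrightarrow> \<epsilon> * (1 + \<bar>n / m\<bar>) \<le> frac (y + (k - x) * (n / m))"
      "\<And>k. k < m \<Longrightarrow> frac (y + (k - x) * (n / m)) \<le> 1 - \<epsilon> * (1 + \<bar>n / m\<bar>)"
  shows "integral {0..1} (\<lambda>t. m * \<rho> (x + t * m) * B (y + t * n)) =
    (\<Sum>k<m. 1/2 - frac (y + (k - x) * (n / m)))"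
proof -
  define u where "u z = \<rho> z * B (y + (z - x) * (n / m))" for z :: real
  have cont: "continuous_on UNIV u" unfolding u_def by (intro continuous_intros)
  obtain U where U: "\<And>z. (U has_real_derivative u z) (at z)"
    using continuous_antiderivative[OF cont] by metis
  have u_per: "u (z + m) = u z" for z :: real
  proof -
    have "y + (z + m - x) * (n / m) = y + (z - x) * (n / m) + of_int n"
      using m by (simp add: field_simps)
    hence "B (y + (z + m - x) * (n / m)) = B (y + (z - x) * (n / m))"
      by (simp only: saw_plus_int)
    thus ?thesis using bump_plus_int[of z "int m"] by (simp add: u_def)
  qed
  have const: "g x = g y" if "\<And>x. (g has_real_derivative 0) (at x)" for g :: "real \<Rightarrow> real" and x y
    using that DERIV_isconst_all by blast
  \<comment> \<open>The integrand has period m, so the window may start at -1/2. It then splits into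
    unit intervals centred at integers, and no bump is cut.\<close>
  have U_per: "U (x + m) - U x = U (- (1/2) + m) - U (- (1/2))"
    by (rule const[of "\<lambda>x. U (x + m) - U x"])
      (use U u_per DERIV_shift[of U _ _ "real m"] in \<open>auto intro!: derivative_eq_intros\<close>)
  have "((\<lambda>t. u (x + t * m) * m) has_integral U (x + 1 * real m) - U (x + 0 * real m)) {0..1}"
    by (intro fundamental_theorem_of_calculus[where f = "\<lambda>t. U (x + t * real m)"])
      (auto intro!: derivative_eq_intros DERIV_chain2[OF U] simp: has_real_derivative_iff_has_vector_derivative[symmetric])
  moreover have "(\<lambda>t::real. u (x + t * m) * m) = (\<lambda>t::real. m * \<rho> (x + t * m) * B (y + t * n))"
    using m by (auto simp: u_def fun_eq_iff)
  ultimately have "integral {0..1} (\<lambda>t. m * \<rho> (x + t * m) * B (y + t * n)) = U (x + m) - U x"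
    by (simp add: integral_unique)
  also have "\<dots> = (\<Sum>k<m. U (- (1/2) + Suc k) - U (- (1/2) + k))"
    unfolding U_per by (subst sum_lessThan_telescope) simp
  also have "\<dots> = (\<Sum>k<m. 1/2 - frac (y + (k - x) * (n / m)))"
  proof (rule sum.cong)
    fix k assume k: "k \<in> {..<m}"
    define \<theta> where "\<theta> = y + (k - x) * (n / m)"
    have "((\<lambda>z. u (z + k)) has_integral U (1/2 + k) - U (- (1/2) + k)) {- (1/2)..1/2}"
      by (intro fundamental_theorem_of_calculus[where f = "\<lambda>z. U (z + real k)"])
        (auto intro!: has_field_derivative_at_within DERIV_shift[THEN iffD1, OF U]
          simp: has_real_derivative_iff_has_vector_derivative[symmetric])
    moreover have "u (z + k) = \<rho> z * B (\<theta> + z * (n / m))" for z :: real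
    proof -
      have "y + (z + k - x) * (n / m) = \<theta> + z * (n / m)"
        unfolding \<theta>_def by (simp only: algebra_simps)
      thus ?thesis using bump_plus_int[of z "int k"] by (simp add: u_def)
    qed
    ultimately have "((\<lambda>z. \<rho> z * B (\<theta> + z * (n / m))) has_integral U (1/2 + k) - U (- (1/2) + k)) {- (1/2)..1/2}"
      by simp
    moreover have "((\<lambda>z. \<rho> z * B (\<theta> + z * (n / m))) has_integral 1/2 - frac \<theta>) {- (1/2)..1/2}"
      using far k by (intro integral_bump_saw_unit) (auto simp: \<theta>_def)
    ultimately have "U (1/2 + k) - U (- (1/2) + k) = 1/2 - frac \<theta>"
      by (rule has_integral_unique)
    thus "U (- (1/2) + Suc k) - U (- (1/2) + k) = 1/2 - frac (y + (k - x) * (n / m))"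
      by (simp add: \<theta>_def add.commute)
  qed simp
  finally show ?thesis .
qed

end

section \<open>The distribution relation: sums of fractional parts along arithmetic
  progressions\<close>

lemma bij_betw_affine_mod:
  fixes N n L :: int
  assumes "N > 0" "coprime n N"
  shows "bij_betw (\<lambda>k. (L + k * n) mod N) {0..<N} {0..<N}"
proof -
  have inj: "inj_on (\<lambda>k. (L + k * n) mod N) {0..<N}"
  proof
    fix k l assume kl: "k \<in> {0..<N}" "l \<in> {0..<N}" "(L + k * n) mod N = (L + l * n) mod N"
    hence "N dvd (L + k * n) - (L + l * n)" by (simp add: mod_eq_dvd_iff)
    hence "N dvd (k - l) * n" by (simp add: algebra_simps)
    hence "N dvd k - l" using assms(2) by (simp add: coprime_commute coprime_dvd_mult_left_iff)
    thus "k = l" using kl zdvd_imp_le[of N "\<bar>k - l\<bar>"] by (cases "k = l") auto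
  qed
  moreover have "(\<lambda>k. (L + k * n) mod N) ` {0..<N} = {0..<N}"
    by (rule endo_inj_surj) (use assms inj in auto)
  ultimately show ?thesis by (simp add: bij_betw_def)
qed

lemma frac_add_of_int_divide:
  fixes \<xi> :: real and N k :: int
  assumes "N > 0"
  shows "frac ((\<xi> + k) / N) = (frac \<xi> + of_int ((\<lfloor>\<xi>\<rfloor> + k) mod N)) / N"
proof (subst frac_unique_iff, intro conjI)
  have "(\<xi> + k) / N - (frac \<xi> + of_int ((\<lfloor>\<xi>\<rfloor> + k) mod N)) / N =
      of_int ((\<lfloor>\<xi>\<rfloor> + k) - (\<lfloor>\<xi>\<rfloor> + k) mod N) / N"
    by (simp add: frac_def diff_divide_distrib[symmetric])
  also have "\<dots> = of_int ((\<lfloor>\<xi>\<rfloor> + k) div N)"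
    using assms by (simp only: minus_mod_eq_mult_div) simp
  finally show "(\<xi> + k) / N - (frac \<xi> + of_int ((\<lfloor>\<xi>\<rfloor> + k) mod N)) / N \<in> \<int>" by simp
  show "0 \<le> (frac \<xi> + of_int ((\<lfloor>\<xi>\<rfloor> + k) mod N)) / N" using assms by simp
  have "(\<lfloor>\<xi>\<rfloor> + k) mod N \<le> N - 1" using assms by simp
  hence "real_of_int ((\<lfloor>\<xi>\<rfloor> + k) mod N) \<le> of_int (N - 1)" by (simp only: of_int_le_iff)
  thus "(frac \<xi> + of_int ((\<lfloor>\<xi>\<rfloor> + k) mod N)) / N < 1"
    using frac_lt_1[of \<xi>] assms by simp
qed

text \<open>Multiplication by n permutes the residues modulo N, so n drops out and the sum is that
  of the equally spaced points (frac \<xi> + k) / N.\<close>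

lemma sum_frac_progression_coprime:
  fixes \<xi> :: real and n :: int and N :: nat
  assumes N: "N > 0" and cop: "coprime n (int N)"
  shows "(\<Sum>k<N. frac ((\<xi> + real k * of_int n) / N)) = frac \<xi> + (real N - 1) / 2"
proof -
  have "(\<Sum>k<N. frac ((\<xi> + real k * of_int n) / N)) = (\<Sum>k<N. (frac \<xi> + of_int ((\<lfloor>\<xi>\<rfloor> + int k * n) mod int N)) / N)"
    using frac_add_of_int_divide[of "int N" \<xi> "int k * n" for k] N by simp
  also have "\<dots> = (\<Sum>k\<in>{0..<int N}. (frac \<xi> + of_int ((\<lfloor>\<xi>\<rfloor> + k * n) mod int N)) / N)"
    by (rule sum.reindex_bij_witness[of _ nat int]) auto
  also have "\<dots> = (\<Sum>k\<in>{0..<int N}. (frac \<xi> + of_int k) / N)"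
    by (rule sum.reindex_bij_betw[OF bij_betw_affine_mod]) (use N cop in auto)
  also have "\<dots> = (\<Sum>k<N. (frac \<xi> + k) / N)"
    by (rule sum.reindex_bij_witness[of _ int nat]) auto
  also have "\<dots> = frac \<xi> + (\<Sum>k<N. real k) / N"
    using N by (simp add: sum_divide_distrib[symmetric] sum.distrib field_simps)
  also have "(\<Sum>k<N. real k) = N * (real N - 1) / 2"
    by (induction N) (auto simp: field_simps)
  finally show ?thesis using N by simp
qed

text \<open>Shifting k by a multiple of N changes the argument by an integer, so the sum consists of
  g equal blocks. This covers slopes m and n with common factor g.\<close>

lemma sum_frac_progression:
  fixes \<xi> :: real and n :: int and N g :: nat
  assumes N: "N > 0" and cop: "coprime n (int N)"
  shows "(\<Sum>k<g * N. frac ((\<xi> + real k * of_int n) / N)) = g * (frac \<xi> + (real N - 1) / 2)"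
proof -
  have "(\<Sum>k<g * N. frac ((\<xi> + real k * of_int n) / N)) = (\<Sum>l<g. \<Sum>k=l * N..<l * N + N. frac ((\<xi> + real k * of_int n) / N))"
    by (rule sum.nat_group[symmetric])
  also have "\<dots> = (\<Sum>l<g. \<Sum>k<N. frac ((\<xi> + real k * of_int n) / N))"
  proof (rule sum.cong)
    fix l
    have "(\<Sum>k=l * N..<l * N + N. frac ((\<xi> + real k * of_int n) / N)) = (\<Sum>k<N. frac ((\<xi> + (k + l * N) * n) / N))"
      by (rule sum.reindex_bij_witness[of _ "\<lambda>k. k + l * N" "\<lambda>k. k - l * N"]) auto
    also have "\<dots> = (\<Sum>k<N. frac ((\<xi> + real k * of_int n) / N))"
    proof (rule sum.cong)
      fix k
      have "(\<xi> + (k + l * N) * n) / N = (\<xi> + real k * of_int n) / N + of_int (int l * n)"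
        using N by (simp add: field_simps)
      thus "frac ((\<xi> + (k + l * N) * n) / N) = frac ((\<xi> + real k * of_int n) / N)"
        by (simp only: frac_add_of_int_right)
    qed simp
    finally show "(\<Sum>k=l * N..<l * N + N. frac ((\<xi> + real k * of_int n) / N)) = (\<Sum>k<N. frac ((\<xi> + real k * of_int n) / N))" .
  qed simp
  finally show ?thesis by (simp add: sum_frac_progression_coprime[OF assms])
qed

section \<open>The line integral of the form in transverse coordinates\<close>

lemma Ints_margin:
  assumes "finite A" "A \<inter> \<int> = {}"
  shows "\<exists>\<delta>>0. \<forall>x\<in>A. \<delta> \<le> frac x \<and> frac x \<le> 1 - (\<delta> :: real)"
  using assms
proof (induction A)
  case (insert a A)
  then obtain \<delta> where d: "\<delta> > 0" "\<forall>x\<in>A. \<delta> \<le> frac x \<and> frac x \<le> 1 - \<delta>" by auto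
  have "frac a > 0" "frac a < 1" using insert by (auto simp: frac_gt_0_iff frac_lt_1)
  thus ?case using d by (intro exI[of _ "min \<delta> (min (frac a) (1 - frac a))"]) auto
qed (auto intro: exI[of _ 1])

lemma integral_reverse_unit:
  fixes f :: "real \<Rightarrow> real"
  shows "integral {0..1} (\<lambda>t. f (1 - t)) = integral {0..1} f"
proof -
  have "integral {0..1} (\<lambda>t. f (1 - t)) = integral {- 1..- 0} (\<lambda>t. f (- t))"
    using Henstock_Kurzweil_Integration.integral_shift_real_ivl[where a = "- 1" and b = 0 and c = "- 1" and f = "\<lambda>t. f (- t)"] by simp
  thus ?thesis by (simp only: Henstock_Kurzweil_Integration.integral_reflect_real)
qed

text \<open>The term with B(X) alone has mean zero. The bump term samples the sawtooth whenever X is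
  an integer k, where Y equals (\<xi> + k n') / m'; the distribution relation collapses the m
  samples to g times the value at \<xi>. The threshold for \<epsilon> is a margin of the samples
  from the integers, divided by 1 + |n / m|.\<close>

lemma geodesic_integral_pos:
  fixes x y :: real and m n m' n' g :: int
  assumes mn: "m = g * m'" "n = g * n'" "g > 0" "coprime m' n'" and m': "m' > 0"
    and avoid: "\<And>t::real. x + t * m \<notin> \<int> \<or> y + t * n \<notin> \<int>"
  shows "n' * x - m' * y \<notin> \<int>"
    and "\<exists>\<epsilon>\<^sub>0>0. \<forall>\<epsilon> (\<rho>::real\<Rightarrow>real) (B::real\<Rightarrow>real). sawtooth \<epsilon> \<rho> B \<longrightarrow> \<epsilon> \<le> \<epsilon>\<^sub>0 \<longrightarrow>
      integral {0..1} (\<lambda>t. n * B (x + t * m) - m * \<rho> (x + t * m) * B (y + t * n)) =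
        g * (1/2 - frac (n' * x - m' * y))"
proof -
  define M where "M = nat m"
  define N where "N = nat m'"
  define G where "G = nat g"
  define \<xi> where "\<xi> = m' * y - n' * x"
  have m: "m > 0" using mn m' by simp
  have MN: "M = G * N" "N > 0" "M > 0" "int N = m'" "int M = m" "int G = g"
    using mn m' m by (simp_all add: M_def N_def G_def nat_mult_distrib)
  have real_eq: "real N = m'" "real M = m" "real G = g"
    by (metis MN(4) of_int_of_nat_eq, metis MN(5) of_int_of_nat_eq, metis MN(6) of_int_of_nat_eq)
  have cop: "coprime n' (int N)" using mn(4) MN by (simp add: coprime_commute)
  have \<theta>: "y + (k - x) * (n / m) = (\<xi> + k * of_int n') / N" for k :: real
  proof -
    have nm: "n / m = n' / m'" using mn by simp
    show ?thesis using m' unfolding \<xi>_def real_eq nm by (simp add: field_simps)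
  qed
  have not_int: "(\<xi> + real k * n') / N \<notin> \<int>" for k
  proof -
    \<comment> \<open>This is the time at which X takes the value k; by \<open>avoid\<close>, Y is
      not an integer then.\<close>
    have "x + ((k - x) / m) * m = k" using m by simp
    hence "y + ((k - x) / m) * n \<notin> \<int>" using avoid[of "(k - x) / m"] by (auto simp: Ints_of_nat)
    thus ?thesis using \<theta>[of k] by simp
  qed
  have \<xi>: "\<xi> \<notin> \<int>"
  proof
    assume "\<xi> \<in> \<int>"
    then obtain L where L: "\<xi> = of_int L" by (rule Ints_cases)
    \<comment> \<open>If \<xi> were an integer L, the progression L + k n' would meet 0 modulo N,
      and that sample would be an integer.\<close>
    have "bij_betw (\<lambda>k. (L + k * n') mod int N) {0..<int N} {0..<int N}"
      by (rule bij_betw_affine_mod) (use MN cop in auto)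
    hence "0 \<in> (\<lambda>k. (L + k * n') mod int N) ` {0..<int N}"
      using MN by (simp add: bij_betw_def)
    then obtain k where k: "k \<ge> 0" "(L + k * n') mod int N = 0" by auto
    then obtain r where r: "L + k * n' = int N * r" by (auto simp: mod_eq_0_iff_dvd)
    have "\<xi> + real (nat k) * n' = of_int (L + k * n')" using k L by simp
    also have "\<dots> = N * of_int r" by (simp only: r of_int_mult) simp
    finally have "(\<xi> + real (nat k) * n') / N = of_int r" using MN(2) by (simp only: divide_eq_eq) simp
    thus False using not_int[of "nat k"] by (metis Ints_of_int)
  qed
  have neg: "n' * x - m' * y = - \<xi>" by (simp add: \<xi>_def)
  show "n' * x - m' * y \<notin> \<int>" using \<xi> unfolding neg by simp
  define A where "A = (\<lambda>k. (\<xi> + real k * n') / N) ` {..<M}"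
  have "\<exists>\<delta>>0. \<forall>x\<in>A. \<delta> \<le> frac x \<and> frac x \<le> 1 - \<delta>"
    by (rule Ints_margin) (auto simp: A_def not_int)
  then obtain \<delta> where \<delta>: "\<delta> > 0" "\<And>x. x \<in> A \<Longrightarrow> \<delta> \<le> frac x \<and> frac x \<le> 1 - \<delta>" by blast
  define s where "s = 1 + \<bar>real_of_int n / m\<bar>"
  have s: "s > 0" by (simp add: s_def add_pos_nonneg)
  have main: "integral {0..1} (\<lambda>t. n * B (x + t * m) - m * \<rho> (x + t * m) * B (y + t * n)) =
        g * (1/2 - frac (n' * x - m' * y))" if saw: "sawtooth \<epsilon> \<rho> B" and le: "\<epsilon> \<le> \<delta> / s" for \<epsilon> and \<rho> B :: "real \<Rightarrow> real"
  proof -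
    interpret sawtooth \<epsilon> \<rho> B by (rule saw)
    have \<epsilon>: "\<epsilon> * s \<le> \<delta>" using le s by (simp add: pos_le_divide_eq)
    have "integral {0..1} (\<lambda>t. M * \<rho> (x + t * M) * B (y + t * n)) =
        (\<Sum>k<M. 1/2 - frac (y + (k - x) * (n / M)))"
    proof (rule integral_bump_saw_sum)
      fix k assume k: "k < M"
      hence "y + (k - x) * (n / M) \<in> A" unfolding A_def using \<theta>[of k] by (auto simp: real_eq)
      thus "\<epsilon> * (1 + \<bar>n / M\<bar>) \<le> frac (y + (k - x) * (n / M))"
        "frac (y + (k - x) * (n / M)) \<le> 1 - \<epsilon> * (1 + \<bar>n / M\<bar>)"
        using \<delta>(2) \<epsilon> unfolding real_eq s_def by force+
    qed (use MN in auto)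
    also have "\<dots> = M / 2 - (\<Sum>k<G * N. frac ((\<xi> + real k * of_int n') / N))"
      unfolding real_eq(2) \<theta> by (simp add: sum_subtractf real_eq(2) MN(1)[symmetric])
    also have "\<dots> = G * (1/2 - frac \<xi>)"
      unfolding sum_frac_progression[OF MN(2) cop] using MN(2) by (simp add: MN(1) field_simps)
    finally have W: "integral {0..1} (\<lambda>t. m * \<rho> (x + t * m) * B (y + t * n)) = g * (1/2 - frac \<xi>)"
      by (simp only: real_eq)
    have "integral {0..1} (\<lambda>t. n * B (x + t * m) - m * \<rho> (x + t * m) * B (y + t * n)) =
       integral {0..1} (\<lambda>t. n * B (x + t * m)) - integral {0..1} (\<lambda>t. m * \<rho> (x + t * m) * B (y + t * n))"
      by (intro Henstock_Kurzweil_Integration.integral_diff integrable_continuous_interval continuous_intros)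
    also have "integral {0..1} (\<lambda>t. n * B (x + t * m)) = 0"
      using integral_saw_multiple[of m x] m by simp
    \<comment> \<open>Off the integers 1/2 - frac is an odd function, which absorbs the minus sign
      of the bump term.\<close>
    finally show ?thesis unfolding W neg using \<xi> by (simp add: frac_neg algebra_simps)
  qed
  show "\<exists>\<epsilon>\<^sub>0>0. \<forall>\<epsilon> (\<rho>::real\<Rightarrow>real) (B::real\<Rightarrow>real). sawtooth \<epsilon> \<rho> B \<longrightarrow> \<epsilon> \<le> \<epsilon>\<^sub>0 \<longrightarrow>
      integral {0..1} (\<lambda>t. n * B (x + t * m) - m * \<rho> (x + t * m) * B (y + t * n)) =
        g * (1/2 - frac (n' * x - m' * y))"
    using main \<delta>(1) s by (intro exI[of _ "\<delta> / s"]) auto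
qed

text \<open>A negative m' is made positive by running the geodesic backwards: up to integers the
  reversed path has the same starting point and slopes -m, -n. Both sides of the identity change
  sign.\<close>

lemma geodesic_integral:
  fixes x y :: real and m n m' n' g :: int
  assumes mn: "m = g * m'" "n = g * n'" "g > 0" "coprime m' n'"
    and avoid: "\<And>t::real. x + t * m \<notin> \<int> \<or> y + t * n \<notin> \<int>"
  shows "\<exists>\<epsilon>\<^sub>0>0. \<forall>\<epsilon> (\<rho>::real\<Rightarrow>real) (B::real\<Rightarrow>real). sawtooth \<epsilon> \<rho> B \<longrightarrow> \<epsilon> \<le> \<epsilon>\<^sub>0 \<longrightarrow>
      integral {0..1} (\<lambda>t. n * B (x + t * m) - m * \<rho> (x + t * m) * B (y + t * n)) =
        g * (1/2 - frac (n' * x - m' * y))"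
proof -
  consider "m' > 0" | "m' < 0" | "m' = 0" by linarith
  thus ?thesis
  proof cases
    case 1
    thus ?thesis using geodesic_integral_pos(2)[OF mn _ avoid] by simp
  next
    case 2
    have avoid': "x + t * of_int (- m) \<notin> \<int> \<or> y + t * of_int (- n) \<notin> \<int>" for t
      using avoid[of "- t"] by simp
    have mn': "- m = g * (- m')" "- n = g * (- n')" "coprime (- m') (- n')" using mn by auto
    note pos = geodesic_integral_pos[OF mn'(1,2) mn(3) mn'(3) _ avoid']
    have nint: "of_int n' * x - of_int m' * y \<notin> \<int>"
    proof
      assume "of_int n' * x - of_int m' * y \<in> \<int>"
      hence "- (of_int n' * x - of_int m' * y) \<in> \<int>" by (rule Ints_minus)
      thus False using pos(1) 2 by simp
    qed
    have "frac (- (of_int n' * x - of_int m' * y)) = 1 - frac (of_int n' * x - of_int m' * y)"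
      using nint by (simp only: frac_neg) simp
    hence fr: "frac (of_int (- n') * x - of_int (- m') * y) = 1 - frac (of_int n' * x - of_int m' * y)"
      by simp
    obtain e where e: "e > 0" "\<And>\<epsilon> (\<rho>::real\<Rightarrow>real) (B::real\<Rightarrow>real). sawtooth \<epsilon> \<rho> B \<Longrightarrow> \<epsilon> \<le> e \<Longrightarrow>
      integral {0..1} (\<lambda>t. of_int (- n) * B (x + t * of_int (- m)) - of_int (- m) * \<rho> (x + t * of_int (- m)) * B (y + t * of_int (- n))) =
        g * (1/2 - frac (of_int (- n') * x - of_int (- m') * y))"
      using pos(2) 2 by auto
    have "integral {0..1} (\<lambda>t. n * B (x + t * m) - m * \<rho> (x + t * m) * B (y + t * n)) =
        g * (1/2 - frac (n' * x - m' * y))" if saw: "sawtooth \<epsilon> \<rho> B" and le: "\<epsilon> \<le> e" for \<epsilon> and \<rho> B :: "real \<Rightarrow> real"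
    proof -
      interpret sawtooth \<epsilon> \<rho> B by (rule saw)
      have "integral {0..1} (\<lambda>t. n * B (x + t * m) - m * \<rho> (x + t * m) * B (y + t * n)) =
        integral {0..1} (\<lambda>t. n * B (x + (1 - t) * m) - m * \<rho> (x + (1 - t) * m) * B (y + (1 - t) * n))"
        by (rule integral_reverse_unit[symmetric])
      also have "\<dots> = integral {0..1} (\<lambda>t. - (of_int (- n) * B (x + t * of_int (- m)) -
         of_int (- m) * \<rho> (x + t * of_int (- m)) * B (y + t * of_int (- n))))"
      proof (rule integral_cong)
        fix t :: real
        have "x + (1 - t) * m = x + t * of_int (- m) + of_int m"
          "y + (1 - t) * n = y + t * of_int (- n) + of_int n"
          by (simp_all add: algebra_simps)
        thus "n * B (x + (1 - t) * m) - m * \<rho> (x + (1 - t) * m) * B (y + (1 - t) * n) =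
          - (of_int (- n) * B (x + t * of_int (- m)) -
          of_int (- m) * \<rho> (x + t * of_int (- m)) * B (y + t * of_int (- n)))"
          by (simp only: saw_plus_int bump_plus_int of_int_minus minus_diff_eq)
      qed
      also have "\<dots> = - (g * (1/2 - frac (of_int (- n') * x - of_int (- m') * y)))"
        by (subst Henstock_Kurzweil_Integration.integral_neg) (simp only: e(2)[OF saw le])
      finally show ?thesis unfolding fr by (simp add: algebra_simps)
    qed
    thus ?thesis using e(1) by blast
  next
    case 3
    \<comment> \<open>Here X is constant, so the bump term is absent and only n B(x) remains. At the
      time -y / n the coordinate Y vanishes, so \<open>avoid\<close> keeps x off the
      integers.\<close>
    have "\<bar>n'\<bar> = 1" using mn(4) 3 by simp
    hence n': "n' = 1 \<or> n' = -1" by auto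
    have m: "m = 0" and n: "n \<noteq> 0" using mn 3 n' by auto
    have x: "x \<notin> \<int>" using avoid[of "- y / n"] m n by simp
    obtain e where e: "e > 0" "e \<le> frac x" "frac x \<le> 1 - e"
      using Ints_margin[of "{x}"] x by auto
    have "integral {0..1} (\<lambda>t. n * B (x + t * m) - m * \<rho> (x + t * m) * B (y + t * n)) =
        g * (1/2 - frac (n' * x - m' * y))" if saw: "sawtooth \<epsilon> \<rho> B" and le: "\<epsilon> \<le> e" for \<epsilon> and \<rho> B :: "real \<Rightarrow> real"
    proof -
      interpret sawtooth \<epsilon> \<rho> B by (rule saw)
      have Bx: "B x = 1/2 - frac x" using e le by (intro saw_far) auto
      show ?thesis using n' x by (auto simp: Bx m 3 mn(2) frac_neg algebra_simps)
    qed
    thus ?thesis using e(1) by blast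
  qed
qed

section \<open>Green's theorem for functions of class C1\<close>

lemma continuous_on_uncurried:
  assumes "continuous_on (A \<times> B) (\<lambda>(x, y). f x y)" "continuous_on S u" "continuous_on S v"
    and "\<And>z. z \<in> S \<Longrightarrow> u z \<in> A" "\<And>z. z \<in> S \<Longrightarrow> v z \<in> B"
  shows "continuous_on S (\<lambda>z. f (u z) (v z))"
  using continuous_on_compose2[OF assms(1), of S "\<lambda>z. (u z, v z)"] assms(2-5)
  by (auto intro!: continuous_on_Pair)

text \<open>Mixed second derivatives need not exist. Instead \<open>P r s = \<integral> g(r,t) h\<^sub>2(s,t) dt\<close> is differentiated in both
  variables (in \<open>s\<close> after an integration by parts) and then restricted to the diagonal \<open>r = s\<close>.\<close>
lemma green_unit_square:
  fixes g g\<^sub>1 g\<^sub>2 h h\<^sub>1 h\<^sub>2 :: "real \<Rightarrow> real \<Rightarrow> real"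
  assumes g1: "\<And>r t. r \<in> {0..1} \<Longrightarrow> t \<in> {0..1} \<Longrightarrow> ((\<lambda>r. g r t) has_real_derivative g\<^sub>1 r t) (at r within {0..1})"
    and g2: "\<And>r t. r \<in> {0..1} \<Longrightarrow> t \<in> {0..1} \<Longrightarrow> ((\<lambda>t. g r t) has_real_derivative g\<^sub>2 r t) (at t within {0..1})"
    and h1: "\<And>r t. r \<in> {0..1} \<Longrightarrow> t \<in> {0..1} \<Longrightarrow> ((\<lambda>r. h r t) has_real_derivative h\<^sub>1 r t) (at r within {0..1})"
    and h2: "\<And>r t. r \<in> {0..1} \<Longrightarrow> t \<in> {0..1} \<Longrightarrow> ((\<lambda>t. h r t) has_real_derivative h\<^sub>2 r t) (at t within {0..1})"
    and cont: "continuous_on ({0..1} \<times> {0..1}) (\<lambda>(r, t). g r t)"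
      "continuous_on ({0..1} \<times> {0..1}) (\<lambda>(r, t). g\<^sub>1 r t)"
      "continuous_on ({0..1} \<times> {0..1}) (\<lambda>(r, t). g\<^sub>2 r t)"
      "continuous_on ({0..1} \<times> {0..1}) (\<lambda>(r, t). h r t)"
      "continuous_on ({0..1} \<times> {0..1}) (\<lambda>(r, t). h\<^sub>1 r t)"
      "continuous_on ({0..1} \<times> {0..1}) (\<lambda>(r, t). h\<^sub>2 r t)"
  shows "integral {0..1} (\<lambda>r. integral {0..1} (\<lambda>t. g\<^sub>1 r t * h\<^sub>2 r t - g\<^sub>2 r t * h\<^sub>1 r t)) =
    integral {0..1} (\<lambda>t. g 1 t * h\<^sub>2 1 t) - integral {0..1} (\<lambda>t. g 0 t * h\<^sub>2 0 t) +
    integral {0..1} (\<lambda>r. g r 0 * h\<^sub>1 r 0) - integral {0..1} (\<lambda>r. g r 1 * h\<^sub>1 r 1)"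
proof -
  note [continuous_intros] = cont[THEN continuous_on_uncurried]
  define P where "P r s = integral {0..1} (\<lambda>t. g r t * h\<^sub>2 s t)" for r s
  define P1 where "P1 r s = integral {0..1} (\<lambda>t. g\<^sub>1 r t * h\<^sub>2 s t)" for r s
  define Q where "Q r s = integral {0..1} (\<lambda>t. g\<^sub>2 r t * h\<^sub>1 s t)" for r s
  define P2 where "P2 r s = g r 1 * h\<^sub>1 s 1 - g r 0 * h\<^sub>1 s 0 - Q r s" for r s
  have P1: "((\<lambda>r. P r s) has_real_derivative P1 r s) (at r within {0..1})"
    if "r \<in> {0..1}" "s \<in> {0..1}" for r s
    unfolding P_def P1_def using that
    by (intro leibniz_rule_field_derivative[of "{0..1}" "0::real" 1, unfolded cbox_interval])
      (auto intro!: derivative_eq_intros g1 integrable_continuous_interval continuous_intros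
        simp: split_beta)
  \<comment> \<open>Integration by parts trades \<open>h\<^sub>2\<close> for h, so that
    differentiating in s involves only \<open>h\<^sub>1\<close>.\<close>
  have parts: "P r s = g r 1 * h s 1 - g r 0 * h s 0 - integral {0..1} (\<lambda>t. g\<^sub>2 r t * h s t)"
    if "r \<in> {0..1}" "s \<in> {0..1}" for r s
  proof -
    have "((\<lambda>t. g\<^sub>2 r t * h s t + g r t * h\<^sub>2 s t) has_integral g r 1 * h s 1 - g r 0 * h s 0) {0..1}"
      using that
      by (intro fundamental_theorem_of_calculus)
        (auto intro!: derivative_eq_intros g2 h2 simp: has_real_derivative_iff_has_vector_derivative[symmetric])
    hence "g r 1 * h s 1 - g r 0 * h s 0 = integral {0..1} (\<lambda>t. g\<^sub>2 r t * h s t + g r t * h\<^sub>2 s t)"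
      by (simp add: integral_unique)
    also have "\<dots> = integral {0..1} (\<lambda>t. g\<^sub>2 r t * h s t) + P r s"
      unfolding P_def using that
      by (intro Henstock_Kurzweil_Integration.integral_add integrable_continuous_interval continuous_intros) auto
    finally show ?thesis by simp
  qed
  have P2: "(P r has_real_derivative P2 r s) (at s within {0..1})"
    if "r \<in> {0..1}" "s \<in> {0..1}" for r s
  proof -
    have "((\<lambda>s. integral {0..1} (\<lambda>t. g\<^sub>2 r t * h s t)) has_real_derivative Q r s) (at s within {0..1})"
      unfolding Q_def using that
      by (intro leibniz_rule_field_derivative[of "{0..1}" "0::real" 1, unfolded cbox_interval])
        (auto intro!: derivative_eq_intros h1 integrable_continuous_interval continuous_intros
          simp: split_beta)
    hence "((\<lambda>s. g r 1 * h s 1 - g r 0 * h s 0 - integral {0..1} (\<lambda>t. g\<^sub>2 r t * h s t))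
      has_real_derivative P2 r s) (at s within {0..1})"
      unfolding P2_def using that by (auto intro!: derivative_eq_intros h1)
    thus ?thesis
      by (rule has_field_derivative_transform_within[of _ _ _ _ 1]) (use that parts in auto)
  qed
  have contQ: "continuous_on ({0..1} \<times> {0..1}) (\<lambda>z. Q (fst z) (snd z))"
    unfolding Q_def
    by (rule integral_continuous_on_param[of _ "0::real" 1, unfolded cbox_interval])
      (auto intro!: continuous_intros simp: split_beta)
  have contP2: "continuous_on ({0..1} \<times> {0..1}) (\<lambda>z. P2 (fst z) (snd z))"
    unfolding P2_def by (intro continuous_intros contQ) auto
  \<comment> \<open>Partial derivatives alone do not control the diagonal; joint continuity of P2
    makes P jointly differentiable there, and the chain rule applies.\<close>
  have diag: "((\<lambda>r. P r r) has_real_derivative P1 r r + P2 r r) (at r within {0..1})"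
    if r: "r \<in> {0..1}" for r
  proof -
    have "((\<lambda>(x, y). P x y) has_derivative (\<lambda>(tx, ty). P1 r r * tx + blinfun_mult_right (P2 r r) ty))
        (at (r, r) within {0..1} \<times> {0..1})"
    proof (rule has_derivative_partialsI[where fy = "\<lambda>x y. blinfun_mult_right (P2 x y)"])
      show "continuous (at (r, r) within {0..1} \<times> {0..1}) (\<lambda>(x, y). blinfun_mult_right (P2 x y))"
        using contP2 r unfolding split_beta continuous_on_eq_continuous_within
        by (intro bounded_linear.continuous[OF bounded_linear_blinfun_mult_right]) auto
    qed (use r P1 P2 in \<open>auto simp: has_field_derivative_def\<close>)
    hence "((\<lambda>(x, y). P x y) has_derivative (\<lambda>(tx, ty). P1 r r * tx + P2 r r * ty))
        (at (r, r) within {0..1} \<times> {0..1})"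
      by simp
    hence "((\<lambda>(x, y). P x y) has_derivative (\<lambda>(tx, ty). P1 r r * tx + P2 r r * ty))
        (at (r, r) within (\<lambda>r. (r, r)) ` {0..1})"
      by (rule has_derivative_subset) auto
    hence "((\<lambda>r. (\<lambda>(x, y). P x y) (r, r)) has_derivative (\<lambda>t. (\<lambda>(tx, ty). P1 r r * tx + P2 r r * ty) (t, t)))
        (at r within {0..1})"
      by (rule has_derivative_in_compose[rotated]) (auto intro!: derivative_eq_intros)
    moreover have "(\<lambda>t. P1 r r * t + P2 r r * t) = (*) (P1 r r + P2 r r)"
      by (auto simp: distrib_right)
    ultimately show ?thesis by (simp add: has_field_derivative_def)
  qed
  have int: "(\<lambda>r. P1 r r - Q r r) integrable_on {0..1}" "(\<lambda>r. g r 1 * h\<^sub>1 r 1) integrable_on {0..1}"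
     "(\<lambda>r. g r 0 * h\<^sub>1 r 0) integrable_on {0..1}"
  proof -
    have "continuous_on {0..1} (\<lambda>r. P1 r r)" unfolding P1_def
      by (rule integral_continuous_on_param[of _ "0::real" 1, unfolded cbox_interval])
        (auto intro!: continuous_intros simp: split_beta)
    moreover have "continuous_on {0..1} (\<lambda>r. Q r r)" unfolding Q_def
      by (rule integral_continuous_on_param[of _ "0::real" 1, unfolded cbox_interval])
        (auto intro!: continuous_intros simp: split_beta)
    ultimately show "(\<lambda>r. P1 r r - Q r r) integrable_on {0..1}"
      by (intro integrable_continuous_interval continuous_intros)
  qed (auto intro!: integrable_continuous_interval continuous_intros)
  have "((\<lambda>r. P1 r r + P2 r r) has_integral P 1 1 - P 0 0) {0..1}"
    using diag by (intro fundamental_theorem_of_calculus)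
      (auto simp: has_real_derivative_iff_has_vector_derivative[symmetric])
  hence "P 1 1 - P 0 0 = integral {0..1} (\<lambda>r. P1 r r + P2 r r)"
    by (simp add: integral_unique)
  also have "\<dots> = integral {0..1} (\<lambda>r. (P1 r r - Q r r) + (g r 1 * h\<^sub>1 r 1 - g r 0 * h\<^sub>1 r 0))"
    by (rule integral_cong) (simp add: P2_def)
  also have "\<dots> = integral {0..1} (\<lambda>r. P1 r r - Q r r) +
      (integral {0..1} (\<lambda>r. g r 1 * h\<^sub>1 r 1) - integral {0..1} (\<lambda>r. g r 0 * h\<^sub>1 r 0))"
    using int by (simp add: Henstock_Kurzweil_Integration.integral_add
        Henstock_Kurzweil_Integration.integral_diff integrable_diff)
  also have "integral {0..1} (\<lambda>r. P1 r r - Q r r) =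
      integral {0..1} (\<lambda>r. integral {0..1} (\<lambda>t. g\<^sub>1 r t * h\<^sub>2 r t - g\<^sub>2 r t * h\<^sub>1 r t))"
    unfolding P1_def Q_def
    by (intro integral_cong Henstock_Kurzweil_Integration.integral_diff[symmetric]
        integrable_continuous_interval continuous_intros) auto
  finally show ?thesis unfolding P_def by simp
qed

section \<open>Counting lattice points by the change of variables formula\<close>

lemma pt2_nth [simp]: "pt2 x y $ 1 = x" "pt2 x y $ 2 = y"
  by (simp_all add: pt2_def)

lemma pt2_eta [simp]: "pt2 (v $ 1) (v $ 2) = v"
  by (simp add: vec_eq_iff forall_2)

lemma continuous_on_pt2 [continuous_intros]:
  assumes "continuous_on S f" "continuous_on S g"
  shows "continuous_on S (\<lambda>x. pt2 (f x) (g x))"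
  unfolding pt2_def
proof (rule continuous_on_vec_lambda)
  show "continuous_on S (\<lambda>x. if i = 1 then f x else g x)" for i :: 2
    using assms by (cases "i = 1") auto
qed

text \<open>Iterated integration is carried over from pairs to \<open>real^2\<close> by the
  coordinate bijection, which maps boxes to boxes of equal content.\<close>

lemma integral_cbox_real2:
  fixes \<phi> :: "real^2 \<Rightarrow> real"
  assumes "continuous_on (cbox a b) \<phi>"
  shows "integral (cbox a b) \<phi> = integral {a $ 1..b $ 1} (\<lambda>x. integral {a $ 2..b $ 2} (\<lambda>y. \<phi> (pt2 x y)))"
proof -
  define g where "g = (\<lambda>z. pt2 (fst z) (snd z))"
  define h where "h = (\<lambda>v :: real^2. (v $ 1, v $ 2))"
  have gh: "g (h v) = v" and hg: "h (g z) = z" for v z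
    by (simp_all add: g_def h_def)
  have cont_g: "continuous_on UNIV g" unfolding g_def by (intro continuous_intros)
  have g_box: "g ` cbox u v = cbox (g u) (g v)" for u v
  proof -
    have "g z \<in> cbox (g u) (g v) \<longleftrightarrow> z \<in> cbox u v" for z
      by (cases z, cases u, cases v) (auto simp: g_def mem_box_cart forall_2)
    thus ?thesis by (metis (mono_tags, lifting) gh hg imageI image_iff subsetI subset_antisym)
  qed
  have h_box: "h ` cbox u v = cbox (h u) (h v)" for u v
  proof -
    have "h ` cbox u v = h ` g ` cbox (h u) (h v)" by (simp only: g_box gh)
    thus ?thesis by (simp add: image_image hg)
  qed
  have "(\<phi> has_integral integral (cbox a b) \<phi>) (cbox a b)"
    using assms by (simp add: integrable_continuous integrable_integral)
  hence "((\<lambda>z. \<phi> (g z)) has_integral (1 / 1) *\<^sub>R integral (cbox a b) \<phi>) (h ` cbox a b)"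
  proof (rule has_integral_twiddle[rotated -1])
    show "isCont g x" for x
      using cont_g continuous_on_eq_continuous_at[OF open_UNIV] by blast
    show "measure lborel (g ` cbox u v) = 1 * measure lborel (cbox u v)" for u v
    proof (cases "cbox u v = {}")
      case True
      thus ?thesis by simp
    next
      case False
      hence ne: "cbox (g u) (g v) \<noteq> {}" using g_box[of u v] by auto
      obtain u1 u2 v1 v2 where uv: "u = (u1, u2)" "v = (v1, v2)" by (cases u, cases v)
      have "u1 \<le> v1" "u2 \<le> v2" using False by (auto simp: uv cbox_Pair_eq)
      thus ?thesis using ne unfolding g_box content_cbox_cart[OF ne]
        by (simp add: UNIV_2 uv g_def content_Pair)
    qed
    show "\<exists>w z. g ` cbox u v = cbox w z" "\<exists>w z. h ` cbox u' v' = cbox w z" for u v u' v'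
      using g_box h_box by blast+
  qed (use gh hg in auto)
  hence "integral (h ` cbox a b) (\<lambda>z. \<phi> (g z)) = integral (cbox a b) \<phi>"
    by (simp add: integral_unique)
  hence "integral (cbox a b) \<phi> = integral (cbox (a $ 1, a $ 2) (b $ 1, b $ 2)) (\<lambda>z. \<phi> (g z))"
    unfolding h_box unfolding h_def by simp
  also have "\<dots> = integral {a $ 1..b $ 1} (\<lambda>x. integral {a $ 2..b $ 2} (\<lambda>y. \<phi> (g (x, y))))"
  proof (subst integral_prod_continuous)
    have "g ` cbox (h a) (h b) \<subseteq> cbox a b" by (simp add: g_box gh)
    moreover have "continuous_on (cbox (h a) (h b)) g"
      using cont_g by (rule continuous_on_subset) simp
    ultimately show "continuous_on (cbox (a $ 1, a $ 2) (b $ 1, b $ 2)) (\<lambda>z. \<phi> (g z))"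
      using assms unfolding h_def by (blast intro: continuous_on_compose2)
  qed simp
  finally show ?thesis by (simp add: g_def)
qed

text \<open>The change of variables formula for vector-valued integrands, read through
  \<open>real^1\<close>.\<close>

lemma has_integral_change_of_variables_real_valued:
  fixes f :: "real^'m::{finite,wellorder} \<Rightarrow> real" and g :: "real^'m::_ \<Rightarrow> real^'m::_"
  assumes S: "S \<in> sets lebesgue"
    and der: "\<And>x. x \<in> S \<Longrightarrow> (g has_derivative g' x) (at x within S)"
    and inj: "inj_on g S"
    and f: "f absolutely_integrable_on (g ` S)"
  shows "((\<lambda>x. \<bar>det (matrix (g' x))\<bar> * f (g x)) has_integral integral (g ` S) f) S"
proof -
  define F where "F y = (vec (f y) :: real^1)" for y
  have "F absolutely_integrable_on (g ` S)"
    using f by (simp add: F_def absolutely_integrable_on_1_iff)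
  hence "(\<lambda>x. \<bar>det (matrix (g' x))\<bar> *\<^sub>R F (g x)) absolutely_integrable_on S"
    "integral S (\<lambda>x. \<bar>det (matrix (g' x))\<bar> *\<^sub>R F (g x)) = integral (g ` S) F"
    using has_absolute_integral_change_of_variables[OF S der inj, of F "integral (g ` S) F"] by auto
  hence "(\<lambda>x. \<bar>det (matrix (g' x))\<bar> * f (g x)) absolutely_integrable_on S"
    "integral S (\<lambda>x. \<bar>det (matrix (g' x))\<bar> * f (g x)) = integral (g ` S) f"
    by (simp_all add: F_def absolutely_integrable_on_1_iff integral_on_1_eq)
  thus ?thesis
    by (metis integrable_integral set_lebesgue_integral_eq_integral(1))
qed

section \<open>The product of two bumps as a unit mass at each lattice point of the plane\<close>

context sawtooth begin

lemma integral_bump_period: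
  fixes w :: real assumes "w \<in> \<int>"
  shows "integral {w - 1/2..w + 1/2} \<rho> = 1"
proof -
  have "(\<rho> has_integral (B (w + 1/2) + (w + 1/2)) - (B (w - 1/2) + (w - 1/2))) {w - 1/2..w + 1/2}"
    by (intro fundamental_theorem_of_calculus)
      (auto intro!: derivative_eq_intros has_field_derivative_at_within[OF deriv_saw]
        simp: has_real_derivative_iff_has_vector_derivative[symmetric])
  thus ?thesis using periodic_saw[of "w - 1/2"] by (simp add: integral_unique add.commute)
qed

lemma bump_supp_near_int:
  fixes w x :: real
  assumes "w \<in> \<int>" "\<epsilon> \<le> \<bar>x - w\<bar>" "\<bar>x - w\<bar> \<le> 1/2"
  shows "\<rho> x = 0"
proof -
  obtain k where k: "w = of_int k" using assms(1) by (rule Ints_cases)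
  have "\<rho> (x - w) = 0" using assms by (intro bump_supp)
  thus ?thesis using bump_plus_int[of "x - w" k] k by simp
qed

lemma bump_nonzero_near_int:
  assumes "\<rho> x \<noteq> 0"
  shows "\<exists>k::int. \<bar>x - k\<bar> < \<epsilon>"
proof -
  have "frac x < \<epsilon> \<or> frac x > 1 - \<epsilon>" using bump_far[of x] assms by linarith
  thus ?thesis
  proof
    assume "frac x < \<epsilon>"
    thus ?thesis using frac_ge_0[of x] by (intro exI[of _ "\<lfloor>x\<rfloor>"]) (simp add: frac_def)
  next
    assume "frac x > 1 - \<epsilon>"
    thus ?thesis using frac_lt_1[of x] by (intro exI[of _ "\<lfloor>x\<rfloor> + 1"]) (simp add: frac_def)
  qed
qed

text \<open>Within the unit square around w the product vanishes off the \<epsilon>-square, so any T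
  between the two squares carries the full mass. The freedom in the shape of T is needed for images
  of balls under a nonlinear map.\<close>

lemma has_integral_bump_product:
  fixes w :: "real^2"
  assumes w: "w $ 1 \<in> \<int>" "w $ 2 \<in> \<int>"
  defines "D \<equiv> cbox (w - pt2 (1/2) (1/2)) (w + pt2 (1/2) (1/2))"
  assumes T: "T \<subseteq> D" "\<And>y. \<bar>y $ 1 - w $ 1\<bar> \<le> \<epsilon> \<Longrightarrow> \<bar>y $ 2 - w $ 2\<bar> \<le> \<epsilon> \<Longrightarrow> y \<in> T"
  shows "((\<lambda>y. \<rho> (y $ 1) * \<rho> (y $ 2)) has_integral 1) T"
proof -
  have cont: "continuous_on D (\<lambda>y. \<rho> (y $ 1) * \<rho> (y $ 2))" by (intro continuous_intros)
  have int1: "integral D (\<lambda>y. \<rho> (y $ 1) * \<rho> (y $ 2)) = 1"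
  proof -
    have "integral D (\<lambda>y. \<rho> (y $ 1) * \<rho> (y $ 2)) =
        integral {w $ 1 - 1/2..w $ 1 + 1/2} (\<lambda>x. integral {w $ 2 - 1/2..w $ 2 + 1/2} (\<lambda>y. \<rho> x * \<rho> y))"
      unfolding D_def by (subst integral_cbox_real2[OF cont[unfolded D_def]]) (simp only: pt2_nth vector_add_component vector_minus_component)
    thus ?thesis by (simp only: integral_mult_right integral_bump_period[OF w(1)] integral_bump_period[OF w(2)] mult_1_right)
  qed
  have "((\<lambda>y. \<rho> (y $ 1) * \<rho> (y $ 2)) has_integral integral D (\<lambda>y. \<rho> (y $ 1) * \<rho> (y $ 2))) D"
    unfolding D_def by (rule integrable_integral[OF integrable_continuous[OF cont[unfolded D_def]]])
  hence "((\<lambda>y. \<rho> (y $ 1) * \<rho> (y $ 2)) has_integral 1) D"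
    by (simp only: int1)
  moreover have "(if y \<in> T then \<rho> (y $ 1) * \<rho> (y $ 2) else 0) = \<rho> (y $ 1) * \<rho> (y $ 2)" if y: "y \<in> D" for y
  proof (cases "y \<in> T")
    case False
    have "w $ 1 - 1/2 \<le> y $ 1" "y $ 1 \<le> w $ 1 + 1/2" "w $ 2 - 1/2 \<le> y $ 2" "y $ 2 \<le> w $ 2 + 1/2"
      using y by (simp_all add: D_def mem_box_cart forall_2)
    hence "\<bar>y $ 1 - w $ 1\<bar> \<le> 1/2" "\<bar>y $ 2 - w $ 2\<bar> \<le> 1/2"
      unfolding abs_diff_le_iff by blast+
    moreover have "\<epsilon> \<le> \<bar>y $ 1 - w $ 1\<bar> \<or> \<epsilon> \<le> \<bar>y $ 2 - w $ 2\<bar>" using T(2)[of y] False by (metis linear)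
    ultimately have "\<rho> (y $ 1) = 0 \<or> \<rho> (y $ 2) = 0"
      using bump_supp_near_int[OF w(1), of "y $ 1"] bump_supp_near_int[OF w(2), of "y $ 2"] by blast
    thus ?thesis using False by auto
  qed simp
  ultimately have "((\<lambda>y. if y \<in> T then \<rho> (y $ 1) * \<rho> (y $ 2) else 0) has_integral 1) D"
    using has_integral_cong[of D "\<lambda>y. if y \<in> T then \<rho> (y $ 1) * \<rho> (y $ 2) else 0"
        "\<lambda>y. \<rho> (y $ 1) * \<rho> (y $ 2)" 1] by blast
  thus ?thesis using T(1) by simp
qed

end

text \<open>Near a nondegenerate lattice hit, f is injective with open image. The integral is
  therefore the sign of the Jacobian times the mass of the bumps on that image, which is 1 for small
  \<epsilon>.\<close>

lemma local_degree:
  fixes f :: "real^2 \<Rightarrow> real^2" and f' :: "real^2 \<Rightarrow> real^2 \<Rightarrow> real^2"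
  assumes W: "open W" "z \<in> W"
    and der: "\<And>x. x \<in> W \<Longrightarrow> (f has_derivative f' x) (at x)"
    and cont: "\<And>v. continuous_on W (\<lambda>x. f' x v)"
    and J: "det (matrix (f' z)) \<noteq> 0"
    and int: "f z $ 1 \<in> \<int>" "f z $ 2 \<in> \<int>"
  shows "\<exists>V e. open V \<and> z \<in> V \<and> V \<subseteq> W \<and> e > 0 \<and>
    (\<forall>\<epsilon> (\<rho>::real\<Rightarrow>real) (B::real\<Rightarrow>real). sawtooth \<epsilon> \<rho> B \<longrightarrow> \<epsilon> \<le> e \<longrightarrow>
      ((\<lambda>x. \<rho> (f x $ 1) * \<rho> (f x $ 2) * det (matrix (f' x))) has_integral sgn (det (matrix (f' z)))) V)"
proof -
  define J where "J x = det (matrix (f' x))" for x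
  have lin: "linear (f' x)" if "x \<in> W" for x
    using der[OF that] has_derivative_linear by blast
  have J_eq: "J x = f' x (axis 1 1) $ 1 * f' x (axis 2 1) $ 2 - f' x (axis 2 1) $ 1 * f' x (axis 1 1) $ 2" for x
    by (simp add: J_def det_2 matrix_def)
  have contJ: "continuous_on W J"
    unfolding J_eq by (intro continuous_intros cont)
  have contf: "continuous_on W f"
    using der by (meson W(1) continuous_at_imp_continuous_on has_derivative_continuous)
  have inj_z: "inj (f' z)"
    using J lin[OF W(2)] by (metis det_nz_iff_inj matrix_vector_mul(1))
  then obtain g' where g': "linear g'" "g' \<circ> f' z = id"
    using linear_injective_left_inverse[OF lin[OF W(2)]] by blast
  \<comment> \<open>The derivative is continuous only vector by vector. In the plane the two axis
    vectors control the operator norm, and two errors of e/3 stay below e.\<close>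
  have onorm: "\<exists>d>0. \<forall>x. dist z x < d \<longrightarrow> onorm (\<lambda>v. f' x v - f' z v) < e" if "e > 0" for e
  proof -
    have "\<exists>d>0. \<forall>x\<in>W. dist x z < d \<longrightarrow> dist (f' x v) (f' z v) < e / 3" for v
      using cont[of v] W(2) \<open>e > 0\<close> unfolding continuous_on_iff by (metis divide_pos_pos zero_less_numeral)
    then obtain D where D: "\<And>v. D v > 0" "\<And>v x. x \<in> W \<Longrightarrow> dist x z < D v \<Longrightarrow> dist (f' x v) (f' z v) < e / 3"
      by metis
    obtain d0 where d0: "d0 > 0" "ball z d0 \<subseteq> W" using W open_contains_ball by blast
    define d where "d = min d0 (min (D (axis 1 1)) (D (axis 2 1)))"
    have "onorm (\<lambda>v. f' x v - f' z v) < e" if x: "dist z x < d" for x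
    proof -
      have xW: "x \<in> W" using x d0 by (auto simp: d_def)
      have l: "linear (\<lambda>v. f' x v - f' z v)"
        using lin[OF xW] lin[OF W(2)] by (rule linear_compose_sub)
      have bnd: "norm (f' x (axis i 1) - f' z (axis i 1)) \<le> e / 3" for i :: 2
      proof -
        have "dist (f' x (axis i 1)) (f' z (axis i 1)) < e / 3"
          using x D(2)[OF xW] exhaust_2[of i] by (auto simp: d_def dist_commute)
        thus ?thesis by (simp add: dist_norm)
      qed
      have "onorm (\<lambda>v. f' x v - f' z v) \<le> 2 * (e / 3)"
      proof (rule onorm_le)
        fix v :: "real^2"
        have "v = (v $ 1) *\<^sub>R axis 1 1 + (v $ 2) *\<^sub>R axis 2 1"
          by (simp add: vec_eq_iff forall_2 axis_def)
        hence "f' x v - f' z v = f' x ((v $ 1) *\<^sub>R axis 1 1 + (v $ 2) *\<^sub>R axis 2 1)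
            - f' z ((v $ 1) *\<^sub>R axis 1 1 + (v $ 2) *\<^sub>R axis 2 1)"
          by simp
        also have "\<dots> = (v $ 1) *\<^sub>R (f' x (axis 1 1) - f' z (axis 1 1))
            + (v $ 2) *\<^sub>R (f' x (axis 2 1) - f' z (axis 2 1))"
          by (simp only: linear_add[OF l] linear_scale[OF l])
        also have "norm \<dots> \<le> \<bar>v $ 1\<bar> * (e / 3) + \<bar>v $ 2\<bar> * (e / 3)"
          unfolding norm_scaleR[symmetric]
          by (intro norm_triangle_le add_mono) (simp_all only: norm_scaleR mult_left_mono[OF bnd] abs_ge_zero)
        also have "\<dots> \<le> norm v * (e / 3) + norm v * (e / 3)"
          using \<open>e > 0\<close> by (intro add_mono mult_right_mono component_le_norm_cart) auto
        finally show "norm (f' x v - f' z v) \<le> 2 * (e / 3) * norm v" by simp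
      qed
      thus ?thesis using \<open>e > 0\<close> by simp
    qed
    thus ?thesis using d0 D(1) by (intro exI[of _ d]) (auto simp: d_def)
  qed
  obtain r0 where r0: "r0 > 0" "ball z r0 \<subseteq> W" "inj_on f (ball z r0)"
    using has_derivative_locally_injective[OF W(2) W(1) _ g'(2) der onorm] g'(1)
    by (metis linear_conv_bounded_linear)
  have "J z \<noteq> 0" using J by (simp add: J_def)
  obtain r1 where r1: "r1 > 0" "\<And>x. x \<in> W \<Longrightarrow> dist x z < r1 \<Longrightarrow> dist (J x) (J z) < \<bar>J z\<bar>"
    using contJ W(2) \<open>J z \<noteq> 0\<close> unfolding continuous_on_iff by (metis zero_less_abs_iff)
  obtain r2 where r2: "r2 > 0" "\<And>x. x \<in> W \<Longrightarrow> dist x z < r2 \<Longrightarrow> dist (f x) (f z) < 1/2"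
    using contf W(2) unfolding continuous_on_iff by (metis half_gt_zero_iff zero_less_one)
  \<comment> \<open>On this ball f is injective, the Jacobian keeps its sign, and the image stays
    inside the unit square around f z.\<close>
  define r where "r = min r0 (min r1 r2)"
  define V where "V = ball z r"
  have V: "open V" "z \<in> V" "V \<subseteq> W" "inj_on f V"
    using r0 r1(1) r2(1) by (auto simp: V_def r_def intro: inj_on_subset)
  have "open (f ` V)"
    using V contf by (intro invariance_of_domain) (auto intro: continuous_on_subset)
  then obtain e where e: "e > 0" "ball (f z) e \<subseteq> f ` V"
    using V(2) open_contains_ball by (metis imageI)
  have inV: "x \<in> W" "dist x z < r1" "dist x z < r2" if "x \<in> V" for x
    using that V(3) by (auto simp: V_def r_def dist_commute)
  have sgn_J: "J x = sgn (J z) * \<bar>J x\<bar>" if "x \<in> V" for x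
  proof -
    have "\<bar>J x - J z\<bar> < \<bar>J z\<bar>"
      using r1(2)[OF inV(1,2)[OF that]] by (simp add: dist_real_def)
    hence "sgn (J x) = sgn (J z)" by (auto simp: sgn_if)
    thus ?thesis by (metis sgn_mult_abs)
  qed
  have main: "((\<lambda>x. \<rho> (f x $ 1) * \<rho> (f x $ 2) * J x) has_integral sgn (J z)) V"
    if saw: "sawtooth \<epsilon> \<rho> B" and le: "\<epsilon> \<le> e / 3" for \<epsilon> and \<rho> B :: "real \<Rightarrow> real"
  proof -
    interpret sawtooth \<epsilon> \<rho> B by (rule saw)
    let ?h = "\<lambda>y :: real^2. \<rho> (y $ 1) * \<rho> (y $ 2)"
    have sub: "f ` V \<subseteq> cbox (f z - pt2 (1/2) (1/2)) (f z + pt2 (1/2) (1/2))"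
    proof
      fix y assume "y \<in> f ` V"
      hence "norm (y - f z) \<le> 1/2"
        using r2(2) inV by (force simp: dist_norm)
      hence "\<bar>(y - f z) $ i\<bar> \<le> 1/2" for i using component_le_norm_cart order_trans by blast
      hence "f z $ i - 1/2 \<le> y $ i \<and> y $ i \<le> f z $ i + 1/2" for i
        by (simp only: abs_diff_le_iff[symmetric] vector_minus_component)
      thus "y \<in> cbox (f z - pt2 (1/2) (1/2)) (f z + pt2 (1/2) (1/2))"
        by (simp add: mem_box_cart forall_2)
    qed
    have "(?h has_integral 1) (f ` V)"
    proof (rule has_integral_bump_product[OF int sub])
      fix y :: "real^2" assume y: "\<bar>y $ 1 - f z $ 1\<bar> \<le> \<epsilon>" "\<bar>y $ 2 - f z $ 2\<bar> \<le> \<epsilon>"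
      \<comment> \<open>Two coordinate errors of at most \<epsilon> \<le> e/3 keep y inside the ball
        of radius e, hence in the image.\<close>
      have "norm (y - f z) \<le> (\<Sum>i\<in>UNIV. \<bar>(y - f z) $ i\<bar>)" by (rule norm_le_l1_cart)
      also have "\<dots> \<le> 2 * \<epsilon>" using y by (simp add: UNIV_2)
      finally have "dist (f z) y < e" using le e(1) by (simp add: dist_norm norm_minus_commute)
      thus "y \<in> f ` V" using e(2) by auto
    qed
    moreover have "?h absolutely_integrable_on (f ` V)"
    proof (rule set_integrable_subset[OF absolutely_integrable_continuous])
      show "continuous_on (cbox (f z - pt2 (1/2) (1/2)) (f z + pt2 (1/2) (1/2))) ?h"
        by (intro continuous_intros)
    qed (use sub \<open>open (f ` V)\<close> in auto)
    moreover have "((\<lambda>x. \<bar>J x\<bar> * ?h (f x)) has_integral integral (f ` V) ?h) V"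
      if "?h absolutely_integrable_on (f ` V)"
      unfolding J_def
    proof (rule has_integral_change_of_variables_real_valued)
      show "V \<in> sets lebesgue" using V(1) by auto
      show "(f has_derivative f' x) (at x within V)" if "x \<in> V" for x
        using der inV that has_derivative_at_withinI by blast
    qed (use V(4) that in auto)
    ultimately have "((\<lambda>x. \<bar>J x\<bar> * ?h (f x)) has_integral 1) V"
      by (simp add: integral_unique)
    hence "((\<lambda>x. sgn (J z) * (\<bar>J x\<bar> * ?h (f x))) has_integral sgn (J z) * 1) V"
      by (rule has_integral_mult_right)
    moreover have "sgn (J z) * (\<bar>J x\<bar> * ?h (f x)) = ?h (f x) * J x" if "x \<in> V" for x
      using sgn_J[OF that] by (metis (no_types, lifting) mult.assoc mult.commute)
    ultimately show ?thesis
      using has_integral_cong[of V "\<lambda>x. sgn (J z) * (\<bar>J x\<bar> * ?h (f x))" "\<lambda>x. ?h (f x) * J x"] by auto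
  qed
  show ?thesis using V e(1) main unfolding J_def
    by (intro exI[of _ V] exI[of _ "e / 3"]) auto
qed

text \<open>Small neighbourhoods of the finitely many lattice hits contribute their signs. The rest
  of K is compact, so its image stays at a positive distance from the closed lattice, and there the
  bump product vanishes once \<epsilon> is small.\<close>

lemma degree_integral:
  fixes f :: "real^2 \<Rightarrow> real^2" and f' :: "real^2 \<Rightarrow> real^2 \<Rightarrow> real^2"
  assumes K: "compact K" "K \<subseteq> U" and U: "open U"
    and der: "\<And>x. x \<in> U \<Longrightarrow> (f has_derivative f' x) (at x)"
    and cont: "\<And>v. continuous_on U (\<lambda>x. f' x v)"
  defines "Z \<equiv> {x \<in> K. f x $ 1 \<in> \<int> \<and> f x $ 2 \<in> \<int>}"
  assumes Z: "finite Z" "Z \<subseteq> interior K" "\<And>z. z \<in> Z \<Longrightarrow> det (matrix (f' z)) \<noteq> 0"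
  shows "\<exists>e>0. \<forall>\<epsilon> (\<rho>::real\<Rightarrow>real) (B::real\<Rightarrow>real). sawtooth \<epsilon> \<rho> B \<longrightarrow> \<epsilon> \<le> e \<longrightarrow>
      integral K (\<lambda>x. \<rho> (f x $ 1) * \<rho> (f x $ 2) * det (matrix (f' x))) = (\<Sum>z\<in>Z. sgn (det (matrix (f' z))))"
proof -
  obtain D where D: "\<And>z. D z > 0" "\<And>z z'. z' \<in> Z \<Longrightarrow> z' \<noteq> z \<Longrightarrow> D z \<le> dist z z'"
    using finite_set_avoid[OF Z(1)] by metis
  define W where "W z = interior K \<inter> ball z (D z / 2)" for z
  have W_disj: "W z \<inter> W z' = {}" if "z \<in> Z" "z' \<in> Z" "z \<noteq> z'" for z z'
  proof (rule ccontr)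
    assume "W z \<inter> W z' \<noteq> {}"
    then obtain x where "dist z x < D z / 2" "dist z' x < D z' / 2" by (auto simp: W_def)
    moreover have "dist z z' \<le> dist z x + dist z' x" by (metis dist_commute dist_triangle)
    ultimately show False using D(2)[of z' z] D(2)[of z z'] that by (simp add: dist_commute)
  qed
  define good where "good z e V \<longleftrightarrow>
    (\<forall>\<epsilon> (\<rho>::real\<Rightarrow>real) (B::real\<Rightarrow>real). sawtooth \<epsilon> \<rho> B \<longrightarrow> \<epsilon> \<le> e \<longrightarrow>
      ((\<lambda>x. \<rho> (f x $ 1) * \<rho> (f x $ 2) * det (matrix (f' x))) has_integral sgn (det (matrix (f' z)))) V)"
    for z e V
  have "\<exists>V e. open V \<and> z \<in> V \<and> V \<subseteq> W z \<and> e > 0 \<and> good z e V"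
    if "z \<in> Z" for z
    unfolding good_def
  proof (rule local_degree)
    have WU: "W z \<subseteq> U" using K(2) interior_subset by (auto simp: W_def)
    show "open (W z)" by (auto simp: W_def)
    show "z \<in> W z" using that Z(2) D(1) by (auto simp: W_def)
    show "(f has_derivative f' x) (at x)" if "x \<in> W z" for x using der WU that by blast
    show "continuous_on (W z) (\<lambda>x. f' x v)" for v using cont WU by (rule continuous_on_subset)
  qed (use that Z(3) in \<open>auto simp: Z_def\<close>)
  then obtain V e where V: "\<And>z. z \<in> Z \<Longrightarrow> open (V z) \<and> z \<in> V z \<and> V z \<subseteq> W z \<and> e z > 0"
    and Vgood: "\<And>z. z \<in> Z \<Longrightarrow> good z (e z) (V z)"
    by metis
  define K' where "K' = K - (\<Union>z\<in>Z. V z)"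
  define L where "L = {y :: real^2. y $ 1 \<in> \<int> \<and> y $ 2 \<in> \<int>}"
  have "compact K'" unfolding K'_def using V K(1) by (intro compact_diff) auto
  moreover have "continuous_on K' f"
    using der K(2) unfolding K'_def
    by (meson Diff_iff continuous_at_imp_continuous_on has_derivative_continuous subsetD)
  ultimately have "compact (f ` K')" by (rule compact_continuous_image[rotated])
  moreover have "closed L"
  proof -
    have "L = (\<lambda>y. y $ 1) -` \<int> \<inter> (\<lambda>y. y $ 2) -` \<int>" by (auto simp: L_def)
    also have "closed \<dots>" by (intro closed_Int closed_vimage closed_Ints continuous_intros)
    finally show ?thesis .
  qed
  moreover have "f ` K' \<inter> L = {}" using V by (auto simp: K'_def L_def Z_def)
  ultimately obtain \<delta> where \<delta>: "\<delta> > 0" "\<And>x y. x \<in> K' \<Longrightarrow> y \<in> L \<Longrightarrow> \<delta> \<le> dist (f x) y"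
    using separate_compact_closed[of "f ` K'" L] by auto
  \<comment> \<open>With \<epsilon> \<le> \<delta>/3, a nonzero bump product would put f x within 2
    \<epsilon> < \<delta> of a lattice point.\<close>
  define m where "m = Min (insert (\<delta> / 3) (e ` Z))"
  have m: "m > 0" "m \<le> \<delta> / 3" "\<And>z. z \<in> Z \<Longrightarrow> m \<le> e z"
    using V \<delta>(1) Z(1) Min_le[of "insert (\<delta> / 3) (e ` Z)" "\<delta> / 3"] by (auto simp: m_def)
  have "integral K (\<lambda>x. \<rho> (f x $ 1) * \<rho> (f x $ 2) * det (matrix (f' x))) = (\<Sum>z\<in>Z. sgn (det (matrix (f' z))))"
    if saw: "sawtooth \<epsilon> \<rho> B" and le: "\<epsilon> \<le> m" for \<epsilon> and \<rho> B :: "real \<Rightarrow> real"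
  proof -
    interpret sawtooth \<epsilon> \<rho> B by (rule saw)
    let ?g = "\<lambda>x. \<rho> (f x $ 1) * \<rho> (f x $ 2) * det (matrix (f' x))"
    have "(?g has_integral (\<Sum>z\<in>Z. sgn (det (matrix (f' z))))) (\<Union>z\<in>Z. V z)"
    proof (rule has_integral_UN)
      show "(?g has_integral sgn (det (matrix (f' z)))) (V z)" if "z \<in> Z" for z
        using Vgood[OF that] saw m(3)[OF that] le unfolding good_def by force
      show "pairwise (\<lambda>z z'. negligible (V z \<inter> V z')) Z"
        unfolding pairwise_def
      proof (intro ballI impI)
        fix z z' assume "z \<in> Z" "z' \<in> Z" "z \<noteq> z'"
        hence "V z \<inter> V z' = {}" using W_disj[of z z'] V by blast
        thus "negligible (V z \<inter> V z')" by simp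
      qed
    qed (rule Z(1))
    moreover have sub: "(\<Union>z\<in>Z. V z) \<subseteq> K"
      using V interior_subset[of K] unfolding W_def by blast
    ultimately have "((\<lambda>x. if x \<in> (\<Union>z\<in>Z. V z) then ?g x else 0) has_integral (\<Sum>z\<in>Z. sgn (det (matrix (f' z))))) K"
      by (simp only: has_integral_restrict)
    moreover have "(if x \<in> (\<Union>z\<in>Z. V z) then ?g x else 0) = ?g x" if x: "x \<in> K" for x
    proof (cases "x \<in> (\<Union>z\<in>Z. V z)")
      case False
      hence xK': "x \<in> K'" using x by (auto simp: K'_def)
      have "\<rho> (f x $ 1) = 0 \<or> \<rho> (f x $ 2) = 0"
      proof (rule ccontr)
        assume "\<not> ?thesis"
        then obtain k l :: int where kl: "\<bar>f x $ 1 - k\<bar> < \<epsilon>" "\<bar>f x $ 2 - l\<bar> < \<epsilon>"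
          using bump_nonzero_near_int by meson
        have "dist (f x) (pt2 k l) \<le> (\<Sum>i\<in>UNIV. \<bar>(f x - pt2 k l) $ i\<bar>)"
          unfolding dist_norm by (rule norm_le_l1_cart)
        also have "\<dots> < 2 * \<epsilon>" using kl by (simp add: UNIV_2)
        also have "\<dots> < \<delta>" using le m(2) \<delta>(1) by simp
        finally show False using \<delta>(2)[OF xK', of "pt2 k l"] by (simp add: L_def)
      qed
      thus ?thesis using False by auto
    qed simp
    ultimately have "(?g has_integral (\<Sum>z\<in>Z. sgn (det (matrix (f' z))))) K"
      using has_integral_cong[of K "\<lambda>x. if x \<in> (\<Union>z\<in>Z. V z) then ?g x else 0" ?g] by blast
    thus ?thesis by (rule integral_unique)
  qed
  thus ?thesis using m(1) by blast
qed

section \<open>Stokes' theorem on a singular simplex\<close>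

lemma has_derivative_partials:
  assumes "\<sigma> differentiable (at x)"
  shows "(\<sigma> has_derivative (\<lambda>w. (w $ 1) *\<^sub>R d1 \<sigma> x + (w $ 2) *\<^sub>R d2 \<sigma> x)) (at x)"
proof -
  have der: "(\<sigma> has_derivative frechet_derivative \<sigma> (at x)) (at x)"
    using assms by (simp add: frechet_derivative_works)
  have lin: "linear (frechet_derivative \<sigma> (at x))" by (rule has_derivative_linear[OF der])
  have "frechet_derivative \<sigma> (at x) w = (w $ 1) *\<^sub>R d1 \<sigma> x + (w $ 2) *\<^sub>R d2 \<sigma> x" for w
  proof -
    have "w = (w $ 1) *\<^sub>R axis 1 1 + (w $ 2) *\<^sub>R axis 2 1"
      by (simp add: vec_eq_iff forall_2 axis_def)
    hence "frechet_derivative \<sigma> (at x) w = frechet_derivative \<sigma> (at x) ((w $ 1) *\<^sub>R axis 1 1 + (w $ 2) *\<^sub>R axis 2 1)"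
      by simp
    thus ?thesis by (simp only: linear_add[OF lin] linear_scale[OF lin] d1_def d2_def)
  qed
  hence "frechet_derivative \<sigma> (at x) = (\<lambda>w. (w $ 1) *\<^sub>R d1 \<sigma> x + (w $ 2) *\<^sub>R d2 \<sigma> x)" by blast
  thus ?thesis using der by simp
qed

lemma has_vector_derivative_pt2:
  assumes "(u has_real_derivative u') (at s within T)" "(v has_real_derivative v') (at s within T)"
  shows "((\<lambda>s. pt2 (u s) (v s)) has_vector_derivative pt2 u' v') (at s within T)"
proof -
  have eq: "pt2 x y = x *\<^sub>R pt2 1 0 + y *\<^sub>R pt2 0 1" for x y
    by (simp add: vec_eq_iff forall_2)
  show ?thesis
    by (subst (1 2) eq) (use assms in \<open>auto intro!: derivative_eq_intros simp: has_real_derivative_iff_has_vector_derivative\<close>)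
qed

lemma iterated_integral_eq:
  fixes f :: "real \<Rightarrow> real \<Rightarrow> real"
  assumes "continuous_on ({0..1} \<times> {0..1}) (\<lambda>z. f (fst z) (snd z))"
  shows "integral {0..1} (\<lambda>r. integral {0..1} (\<lambda>t. f r t)) = integral ({0..1} \<times> {0..1}) (\<lambda>z. f (fst z) (snd z))"
proof -
  have box: "{0..1} \<times> {0..1} = cbox (0, 0) (1 :: real, 1 :: real)" by (simp add: cbox_Pair_eq)
  show ?thesis using assms unfolding box by (subst integral_prod_continuous) simp_all
qed

lemma integrable_continuous_unit_square:
  fixes f :: "real \<times> real \<Rightarrow> real"
  assumes "continuous_on ({0..1} \<times> {0..1}) f"
  shows "f integrable_on {0..1} \<times> {0..1}"
proof -
  have box: "{0..1} \<times> {0..1} = cbox (0, 0) (1 :: real, 1 :: real)" by (simp add: cbox_Pair_eq)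
  show ?thesis using assms unfolding box by (rule integrable_continuous)
qed

lemma iterated_integral_diff:
  fixes f g :: "real \<Rightarrow> real \<Rightarrow> real"
  assumes "continuous_on ({0..1} \<times> {0..1}) (\<lambda>z. f (fst z) (snd z))" "continuous_on ({0..1} \<times> {0..1}) (\<lambda>z. g (fst z) (snd z))"
  shows "integral {0..1} (\<lambda>r. integral {0..1} (\<lambda>t. f r t - g r t)) =
    integral {0..1} (\<lambda>r. integral {0..1} (\<lambda>t. f r t)) - integral {0..1} (\<lambda>r. integral {0..1} (\<lambda>t. g r t))"
  using assms
  by (simp add: iterated_integral_eq continuous_on_diff Henstock_Kurzweil_Integration.integral_diff integrable_continuous_unit_square)

text \<open>Names the neighbourhood hidden in \<open>C1_simplex\<close>, so that derivatives at
  boundary points of the simplex are full derivatives.\<close>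

locale C1_lift =
  fixes \<sigma> :: "real^2 \<Rightarrow> real^3" and U :: "(real^2) set"
  assumes open_U: "open U" and simplex_U: "std_simplex \<subseteq> U"
    and diff: "\<And>x. x \<in> U \<Longrightarrow> \<sigma> differentiable (at x)"
    and cont_d1: "continuous_on U (d1 \<sigma>)" and cont_d2: "continuous_on U (d2 \<sigma>)"
begin

lemma cont_lift: "continuous_on U \<sigma>"
  using diff by (meson continuous_at_imp_continuous_on differentiable_imp_continuous_within)

lemma lift_path_derivative:
  assumes "(u has_real_derivative u') (at s within T)" "(v has_real_derivative v') (at s within T)"
    and "pt2 (u s) (v s) \<in> U"
  shows "((\<lambda>s. \<sigma> (pt2 (u s) (v s))) has_vector_derivative
    u' *\<^sub>R d1 \<sigma> (pt2 (u s) (v s)) + v' *\<^sub>R d2 \<sigma> (pt2 (u s) (v s))) (at s within T)"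
proof -
  have "((\<lambda>s. pt2 (u s) (v s)) has_derivative (\<lambda>h. h *\<^sub>R pt2 u' v')) (at s within T)"
    using has_vector_derivative_pt2[OF assms(1,2)] by (simp add: has_vector_derivative_def)
  hence "((\<lambda>s. \<sigma> (pt2 (u s) (v s))) has_derivative
      (\<lambda>h. ((h *\<^sub>R pt2 u' v') $ 1) *\<^sub>R d1 \<sigma> (pt2 (u s) (v s)) + ((h *\<^sub>R pt2 u' v') $ 2) *\<^sub>R d2 \<sigma> (pt2 (u s) (v s)))) (at s within T)"
    using has_derivative_partials[OF diff[OF assms(3)]] by (rule has_derivative_compose)
  thus ?thesis by (simp add: has_vector_derivative_def scaleR_right_distrib)
qed

lemma inner_lift_path_derivative:
  assumes "(u has_real_derivative u') (at s within T)" "(v has_real_derivative v') (at s within T)"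
    and "pt2 (u s) (v s) \<in> U"
  shows "((\<lambda>s. a \<bullet> (\<sigma> (pt2 (u s) (v s)) - q)) has_real_derivative
    u' * (a \<bullet> d1 \<sigma> (pt2 (u s) (v s))) + v' * (a \<bullet> d2 \<sigma> (pt2 (u s) (v s)))) (at s within T)"
proof -
  have "((\<lambda>s. \<sigma> (pt2 (u s) (v s)) - q) has_derivative
    (\<lambda>h. h *\<^sub>R (u' *\<^sub>R d1 \<sigma> (pt2 (u s) (v s)) + v' *\<^sub>R d2 \<sigma> (pt2 (u s) (v s))))) (at s within T)"
    using lift_path_derivative[OF assms] unfolding has_vector_derivative_def
    by (auto intro!: derivative_eq_intros)
  hence "((\<lambda>s. a \<bullet> (\<sigma> (pt2 (u s) (v s)) - q)) has_derivative
    (\<lambda>h. a \<bullet> (h *\<^sub>R (u' *\<^sub>R d1 \<sigma> (pt2 (u s) (v s)) + v' *\<^sub>R d2 \<sigma> (pt2 (u s) (v s)))))) (at s within T)"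
    by (rule has_derivative_inner_right)
  thus ?thesis
    by (simp add: has_field_derivative_def inner_add_right mult.commute fun_eq_iff)
       (simp add: mult_commute_abs)
qed

lemma collapse_in_U:
  assumes "r \<in> {0..1}" "t \<in> {0..1}"
  shows "pt2 r (t * (1 - r)) \<in> U"
proof -
  have "t * (1 - r) \<le> 1 * (1 - r)" using assms by (intro mult_right_mono) auto
  hence "pt2 r (t * (1 - r)) \<in> std_simplex" using assms by (auto simp: std_simplex_def)
  thus ?thesis using simplex_U by auto
qed

lemma continuous_on_collapse:
  assumes "continuous_on U \<phi>" and "\<And>z. z \<in> S \<Longrightarrow> u z \<in> {0..1}" "\<And>z. z \<in> S \<Longrightarrow> v z \<in> {0..1}"
    and "continuous_on S u" "continuous_on S v"
  shows "continuous_on S (\<lambda>z. \<phi> (pt2 (u z) (v z * (1 - u z))))"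
  using assms collapse_in_U
  by (intro continuous_on_compose2[OF assms(1)] continuous_intros) auto

text \<open>The simplex is parametrized by the square through \<open>(r, t) \<mapsto> (r, t (1 - r))\<close>, which collapses the edge
  \<open>r = 1\<close>. The form \<open>\<rho>(X) B(Y) dX\<close> is written as \<open>B(Y) d(B(X) + X)\<close>, so that only continuity of \<open>\<rho>\<close> is used.\<close>
lemma boundary_int_eq:
  fixes a b q :: "real^3"
  assumes saw: "sawtooth \<epsilon> \<rho> B"
  defines "\<kappa> \<equiv> \<lambda>r t :: real. pt2 r (t * (1 - r))"
  defines "X \<equiv> \<lambda>x. a \<bullet> (\<sigma> x - q)" and "Y \<equiv> \<lambda>x. b \<bullet> (\<sigma> x - q)"
  shows "boundary_int (\<lambda>P. B (a \<bullet> (P - q)) *\<^sub>R b - (\<rho> (a \<bullet> (P - q)) * B (b \<bullet> (P - q))) *\<^sub>R a) \<sigma> =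
    integral {0..1} (\<lambda>r. integral {0..1} (\<lambda>t. (\<rho> (X (\<kappa> r t)) * \<rho> (Y (\<kappa> r t)) - 1) *
      ((1 - r) * (cross3 (d1 \<sigma> (\<kappa> r t)) (d2 \<sigma> (\<kappa> r t)) \<bullet> cross3 a b))))"
proof -
  interpret sawtooth \<epsilon> \<rho> B by (rule saw)
  define D1 where "D1 c r t = c \<bullet> d1 \<sigma> (\<kappa> r t) - t * (c \<bullet> d2 \<sigma> (\<kappa> r t))" for c r t
  define D2 where "D2 c r t = (1 - r) * (c \<bullet> d2 \<sigma> (\<kappa> r t))" for c r t
  define G where "G c r t = c \<bullet> (\<sigma> (\<kappa> r t) - q)" for c r t
  let ?F = "\<lambda>P. B (a \<bullet> (P - q)) *\<^sub>R b - (\<rho> (a \<bullet> (P - q)) * B (b \<bullet> (P - q))) *\<^sub>R a"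
  have G1: "((\<lambda>r. G c r t) has_real_derivative D1 c r t) (at r within T)"
    if "r \<in> {0..1}" "t \<in> {0..1}" for c r t T
    unfolding G_def D1_def \<kappa>_def
    by (rule DERIV_cong[OF inner_lift_path_derivative[of "\<lambda>r. r" 1 _ _ "\<lambda>r. t * (1 - r)" "- t"]])
      (use that collapse_in_U in \<open>auto intro!: derivative_eq_intros\<close>)
  have G2: "((\<lambda>t. G c r t) has_real_derivative D2 c r t) (at t within T)"
    if "r \<in> {0..1}" "t \<in> {0..1}" for c r t T
    unfolding G_def D2_def \<kappa>_def
    by (rule DERIV_cong[OF inner_lift_path_derivative[of "\<lambda>t. r" 0 _ _ "\<lambda>t. t * (1 - r)" "1 - r"]])
      (use that collapse_in_U in \<open>auto intro!: derivative_eq_intros\<close>)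
  have contG: "continuous_on S (\<lambda>z. G c (u z) (v z))" "continuous_on S (\<lambda>z. D1 c (u z) (v z))"
      "continuous_on S (\<lambda>z. D2 c (u z) (v z))"
    if "\<And>z. z \<in> S \<Longrightarrow> u z \<in> {0..1}" "\<And>z. z \<in> S \<Longrightarrow> v z \<in> {0..1}"
      "continuous_on S u" "continuous_on S v" for c and S :: "'z::topological_space set" and u v
    unfolding G_def D1_def D2_def \<kappa>_def using that
    by (intro continuous_intros continuous_on_collapse cont_lift cont_d1 cont_d2; simp)+
  note [continuous_intros] = contG
  define W where "W D r t = B (G a r t) * D b r t - B (G b r t) * (\<rho> (G a r t) * D a r t)" for D :: "real^3 \<Rightarrow> real \<Rightarrow> real \<Rightarrow> real" and r t
  define J where "J r t = (1 - r) * (cross3 (d1 \<sigma> (\<kappa> r t)) (d2 \<sigma> (\<kappa> r t)) \<bullet> cross3 a b)" for r t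
  have J: "D1 a r t * D2 b r t - D2 a r t * D1 b r t = J r t" for r t
    by (simp add: D1_def D2_def J_def dot_cross inner_commute algebra_simps)
  \<comment> \<open>Green's formula is applied to each term of the form: here with g = B(X) and h =
    Y, next with g = B(Y) and h = B(X) + X.\<close>
  have "integral {0..1} (\<lambda>r. integral {0..1} (\<lambda>t. ((\<rho> (G a r t) - 1) * D1 a r t) * D2 b r t - ((\<rho> (G a r t) - 1) * D2 a r t) * D1 b r t)) =
    integral {0..1} (\<lambda>t. B (G a 1 t) * D2 b 1 t) - integral {0..1} (\<lambda>t. B (G a 0 t) * D2 b 0 t) +
    integral {0..1} (\<lambda>r. B (G a r 0) * D1 b r 0) - integral {0..1} (\<lambda>r. B (G a r 1) * D1 b r 1)"
    by (rule green_unit_square)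
      (auto intro!: G1 G2 DERIV_chain2[OF deriv_saw] continuous_intros simp: split_beta)
  moreover have "integral {0..1} (\<lambda>r. integral {0..1} (\<lambda>t. ((\<rho> (G b r t) - 1) * D1 b r t) * (\<rho> (G a r t) * D2 a r t) - ((\<rho> (G b r t) - 1) * D2 b r t) * (\<rho> (G a r t) * D1 a r t))) =
    integral {0..1} (\<lambda>t. B (G b 1 t) * (\<rho> (G a 1 t) * D2 a 1 t)) - integral {0..1} (\<lambda>t. B (G b 0 t) * (\<rho> (G a 0 t) * D2 a 0 t)) +
    integral {0..1} (\<lambda>r. B (G b r 0) * (\<rho> (G a r 0) * D1 a r 0)) - integral {0..1} (\<lambda>r. B (G b r 1) * (\<rho> (G a r 1) * D1 a r 1))"
  proof (rule green_unit_square[where h = "\<lambda>r t. B (G a r t) + G a r t"])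
    fix r t :: real assume rt: "r \<in> {0..1}" "t \<in> {0..1}"
    show "((\<lambda>r. B (G a r t) + G a r t) has_real_derivative \<rho> (G a r t) * D1 a r t) (at r within {0..1})"
      by (rule DERIV_cong[OF DERIV_add[OF DERIV_chain2[OF deriv_saw] G1]])
        (use rt G1 in \<open>auto simp: algebra_simps\<close>)
    show "((\<lambda>t. B (G a r t) + G a r t) has_real_derivative \<rho> (G a r t) * D2 a r t) (at t within {0..1})"
      by (rule DERIV_cong[OF DERIV_add[OF DERIV_chain2[OF deriv_saw] G2]])
        (use rt G2 in \<open>auto simp: algebra_simps\<close>)
  qed (auto intro!: G1 G2 DERIV_chain2[OF deriv_saw] continuous_intros simp: split_beta)
  moreover have W_split:
    "integral {0..1} (\<lambda>r. W D1 r 0) = integral {0..1} (\<lambda>r. B (G a r 0) * D1 b r 0) - integral {0..1} (\<lambda>r. B (G b r 0) * (\<rho> (G a r 0) * D1 a r 0))"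
    "integral {0..1} (\<lambda>r. W D1 r 1) = integral {0..1} (\<lambda>r. B (G a r 1) * D1 b r 1) - integral {0..1} (\<lambda>r. B (G b r 1) * (\<rho> (G a r 1) * D1 a r 1))"
    "integral {0..1} (\<lambda>t. W D2 0 t) = integral {0..1} (\<lambda>t. B (G a 0 t) * D2 b 0 t) - integral {0..1} (\<lambda>t. B (G b 0 t) * (\<rho> (G a 0 t) * D2 a 0 t))"
    unfolding W_def
    by (intro Henstock_Kurzweil_Integration.integral_diff integrable_continuous_interval continuous_intros; simp)+
  \<comment> \<open>The side r = 1 is mapped to a single vertex and contributes nothing.\<close>
  moreover have D2_1: "D2 c 1 t = 0" for c t by (simp add: D2_def)
  ultimately have green: "integral {0..1} (\<lambda>r. integral {0..1} (\<lambda>t. ((\<rho> (G a r t) - 1) * D1 a r t) * D2 b r t - ((\<rho> (G a r t) - 1) * D2 a r t) * D1 b r t))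
    - integral {0..1} (\<lambda>r. integral {0..1} (\<lambda>t. ((\<rho> (G b r t) - 1) * D1 b r t) * (\<rho> (G a r t) * D2 a r t) - ((\<rho> (G b r t) - 1) * D2 b r t) * (\<rho> (G a r t) * D1 a r t)))
    = integral {0..1} (\<lambda>r. W D1 r 0) - integral {0..1} (\<lambda>r. W D1 r 1) - integral {0..1} (\<lambda>t. W D2 0 t)"
    unfolding W_split by simp
  \<comment> \<open>The sides t = 0, t = 1 and r = 0 of the square are the bottom edge, the reversed
    hypotenuse and the reversed left edge, which explains the signs.\<close>
  have "boundary_int ?F \<sigma> = integral {0..1} (\<lambda>r. W D1 r 0) - integral {0..1} (\<lambda>r. W D1 r 1) - integral {0..1} (\<lambda>t. W D2 0 t)"
  proof -
    have 1: "line_int ?F (\<lambda>t. \<sigma> (pt2 t 0)) = integral {0..1} (\<lambda>r. W D1 r 0)"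
      unfolding line_int_def
    proof (rule integral_cong)
      fix t :: real assume t: "t \<in> {0..1}"
      have "vector_derivative (\<lambda>t. \<sigma> (pt2 t 0)) (at t) = 1 *\<^sub>R d1 \<sigma> (pt2 t 0) + 0 *\<^sub>R d2 \<sigma> (pt2 t 0)"
        using t collapse_in_U[of t 0]
        by (intro vector_derivative_at lift_path_derivative) (auto intro!: derivative_eq_intros)
      thus "?F (\<sigma> (pt2 t 0)) \<bullet> vector_derivative (\<lambda>t. \<sigma> (pt2 t 0)) (at t) = W D1 t 0"
        by (simp add: W_def D1_def G_def \<kappa>_def inner_diff_left)
    qed
    have "line_int ?F (\<lambda>t. \<sigma> (pt2 (1 - t) t)) = integral {0..1} (\<lambda>t. - W D1 (1 - t) 1)"
      unfolding line_int_def
    proof (rule integral_cong)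
      fix t :: real assume t: "t \<in> {0..1}"
      have vd: "vector_derivative (\<lambda>t. \<sigma> (pt2 (1 - t) t)) (at t) = (- 1) *\<^sub>R d1 \<sigma> (pt2 (1 - t) t) + 1 *\<^sub>R d2 \<sigma> (pt2 (1 - t) t)"
        using t collapse_in_U[of "1 - t" 1]
        by (intro vector_derivative_at lift_path_derivative) (auto intro!: derivative_eq_intros)
      show "?F (\<sigma> (pt2 (1 - t) t)) \<bullet> vector_derivative (\<lambda>t. \<sigma> (pt2 (1 - t) t)) (at t) = - W D1 (1 - t) 1"
        unfolding vd by (simp add: W_def D1_def G_def \<kappa>_def inner_diff_left inner_diff_right algebra_simps)
    qed
    also have "\<dots> = - integral {0..1} (\<lambda>r. W D1 r 1)"
      by (simp only: Henstock_Kurzweil_Integration.integral_neg integral_reverse_unit[of "\<lambda>r. W D1 r 1"])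
    finally have 2: "line_int ?F (\<lambda>t. \<sigma> (pt2 (1 - t) t)) = - integral {0..1} (\<lambda>r. W D1 r 1)" .
    have "line_int ?F (\<lambda>t. \<sigma> (pt2 0 (1 - t))) = integral {0..1} (\<lambda>t. - W D2 0 (1 - t))"
      unfolding line_int_def
    proof (rule integral_cong)
      fix t :: real assume t: "t \<in> {0..1}"
      have "vector_derivative (\<lambda>t. \<sigma> (pt2 0 (1 - t))) (at t) = 0 *\<^sub>R d1 \<sigma> (pt2 0 (1 - t)) + (- 1) *\<^sub>R d2 \<sigma> (pt2 0 (1 - t))"
        using t collapse_in_U[of 0 "1 - t"]
        by (intro vector_derivative_at lift_path_derivative) (auto intro!: derivative_eq_intros)
      thus "?F (\<sigma> (pt2 0 (1 - t))) \<bullet> vector_derivative (\<lambda>t. \<sigma> (pt2 0 (1 - t))) (at t) = - W D2 0 (1 - t)"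
        by (simp add: W_def D2_def G_def \<kappa>_def inner_diff_left)
    qed
    also have "\<dots> = - integral {0..1} (\<lambda>t. W D2 0 t)"
      by (simp only: Henstock_Kurzweil_Integration.integral_neg integral_reverse_unit[of "\<lambda>t. W D2 0 t"])
    finally show ?thesis unfolding boundary_int_def 1 2 by simp
  qed
  also have "\<dots> = integral {0..1} (\<lambda>r. integral {0..1} (\<lambda>t.
      (((\<rho> (G a r t) - 1) * D1 a r t) * D2 b r t - ((\<rho> (G a r t) - 1) * D2 a r t) * D1 b r t)
      - (((\<rho> (G b r t) - 1) * D1 b r t) * (\<rho> (G a r t) * D2 a r t) - ((\<rho> (G b r t) - 1) * D2 b r t) * (\<rho> (G a r t) * D1 a r t))))"
    unfolding green[symmetric]
    by (rule iterated_integral_diff[symmetric]) (intro continuous_intros; auto)+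
  \<comment> \<open>In the second Green integrand X and Y are interchanged, which reverses its sign;
    so \<rho>(X) - 1 and \<rho>(X) (\<rho>(Y) - 1) add up.\<close>
  also have "\<dots> = integral {0..1} (\<lambda>r. integral {0..1} (\<lambda>t. (\<rho> (G a r t) * \<rho> (G b r t) - 1) * (D1 a r t * D2 b r t - D2 a r t * D1 b r t)))"
    by (simp add: algebra_simps)
  finally show ?thesis unfolding J by (simp add: J_def G_def X_def Y_def)
qed

end

section \<open>Signed intersections of a simplex with a geodesic\<close>

lemma has_derivative_pt2:
  assumes "(f has_derivative f') F" "(g has_derivative g') F"
  shows "((\<lambda>x. pt2 (f x) (g x)) has_derivative (\<lambda>h. pt2 (f' h) (g' h))) F"
proof -
  have eq: "pt2 x y = x *\<^sub>R pt2 1 0 + y *\<^sub>R pt2 0 1" for x y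
    by (simp add: vec_eq_iff forall_2)
  show ?thesis
    by (subst (1 2) eq) (intro has_derivative_add has_derivative_scaleR_left assms)
qed

lemma det_matrix_pt2:
  "det (matrix (\<lambda>w :: real^2. pt2 (\<alpha> w) (\<beta> w))) =
    \<alpha> (axis 1 1) * \<beta> (axis 2 1) - \<alpha> (axis 2 1) * \<beta> (axis 1 1)"
  by (simp add: det_2 matrix_def)

context C1_lift begin

text \<open>Composed with the collapse, (X, Y) becomes a map of the unit square to the plane whose
  lattice hits correspond bijectively to the intersection points. Its Jacobian is 1 - r times the
  transversality determinant, and 1 - r is positive at every hit, so the signs agree.\<close>

lemma simplex_degree:
  fixes a b d e :: "int^3" and q :: "real^3"
  assumes ab: "cross3 (rvec a) (rvec b) = rvec d" and e: "rvec d \<bullet> rvec e = 1"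
    and tr: "transverse_simplex \<sigma> d q"
  defines "\<kappa> \<equiv> \<lambda>r t :: real. pt2 r (t * (1 - r))"
  defines "X \<equiv> \<lambda>x. rvec a \<bullet> (\<sigma> x - q)" and "Y \<equiv> \<lambda>x. rvec b \<bullet> (\<sigma> x - q)"
  shows "\<exists>e>0. \<forall>\<epsilon> (\<rho>::real\<Rightarrow>real) (B::real\<Rightarrow>real). sawtooth \<epsilon> \<rho> B \<longrightarrow> \<epsilon> \<le> e \<longrightarrow>
    integral {0..1} (\<lambda>r. integral {0..1} (\<lambda>t. \<rho> (X (\<kappa> r t)) * \<rho> (Y (\<kappa> r t)) *
      ((1 - r) * (cross3 (d1 \<sigma> (\<kappa> r t)) (d2 \<sigma> (\<kappa> r t)) \<bullet> rvec d)))) = of_int (int_simplex \<sigma> d q)"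
proof -
  define k where "k v = \<kappa> (v $ 1) (v $ 2)" for v :: "real^2"
  define K where "K = cbox (pt2 0 0) (pt2 1 1)"
  define U' where "U' = k -` U"
  define G' where "G' c v w = (w $ 1) * (c \<bullet> d1 \<sigma> (k v)) + ((w $ 2) * (1 - v $ 1) - v $ 2 * w $ 1) * (c \<bullet> d2 \<sigma> (k v))"
    for c :: "real^3" and v w :: "real^2"
  define f where "f v = pt2 (X (k v)) (Y (k v))" for v
  define f' where "f' v w = pt2 (G' (rvec a) v w) (G' (rvec b) v w)" for v w
  define D where "D x = cross3 (d1 \<sigma> x) (d2 \<sigma> x) \<bullet> rvec d" for x
  define Z where "Z = {v \<in> K. f v $ 1 \<in> \<int> \<and> f v $ 2 \<in> \<int>}"
  have contk: "continuous_on UNIV k" unfolding k_def \<kappa>_def by (intro continuous_intros)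
  have K_iff: "v \<in> K \<longleftrightarrow> v $ 1 \<in> {0..1} \<and> v $ 2 \<in> {0..1}" for v
    by (auto simp: K_def mem_box_cart forall_2)
  have k_simplex: "k v \<in> std_simplex" if "v \<in> K" for v
  proof -
    have "v $ 2 * (1 - v $ 1) \<le> 1 * (1 - v $ 1)" using that K_iff by (intro mult_right_mono) auto
    thus ?thesis using that by (auto simp: K_iff k_def \<kappa>_def std_simplex_def)
  qed
  have KU: "K \<subseteq> U'" using k_simplex simplex_U by (auto simp: U'_def)
  have detf: "det (matrix (f' v)) = (1 - v $ 1) * D (k v)" for v
    unfolding f'_def[abs_def] det_matrix_pt2
    by (simp add: G'_def D_def ab[symmetric] dot_cross axis_def inner_commute algebra_simps)
  have der: "(f has_derivative f' v) (at v)" if "v \<in> U'" for v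
  proof -
    have "(k has_derivative (\<lambda>w. pt2 (w $ 1) ((w $ 2) * (1 - v $ 1) - v $ 2 * w $ 1))) (at v)"
    proof -
      have nth: "((\<lambda>w :: real^2. w $ i) has_derivative (\<lambda>w. w $ i)) (at v)" for i
        by (rule bounded_linear_imp_has_derivative[OF bounded_linear_vec_nth])
      have "((\<lambda>v :: real^2. v $ 2 * (1 - v $ 1)) has_derivative (\<lambda>w. v $ 2 * (0 - w $ 1) + w $ 2 * (1 - v $ 1))) (at v)"
        by (intro has_derivative_mult has_derivative_diff has_derivative_const nth)
      thus ?thesis unfolding k_def[abs_def] \<kappa>_def
        by (intro has_derivative_pt2 nth) (simp add: algebra_simps)
    qed
    moreover have "(\<sigma> has_derivative (\<lambda>w. (w $ 1) *\<^sub>R d1 \<sigma> (k v) + (w $ 2) *\<^sub>R d2 \<sigma> (k v))) (at (k v))"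
      using that by (intro has_derivative_partials diff) (simp add: U'_def)
    ultimately have "((\<lambda>v. \<sigma> (k v)) has_derivative
      (\<lambda>w. (w $ 1) *\<^sub>R d1 \<sigma> (k v) + ((w $ 2) * (1 - v $ 1) - v $ 2 * w $ 1) *\<^sub>R d2 \<sigma> (k v))) (at v)"
      by (auto dest: has_derivative_compose)
    hence "((\<lambda>v. \<sigma> (k v) - q) has_derivative
      (\<lambda>w. (w $ 1) *\<^sub>R d1 \<sigma> (k v) + ((w $ 2) * (1 - v $ 1) - v $ 2 * w $ 1) *\<^sub>R d2 \<sigma> (k v))) (at v)"
      by (auto intro!: derivative_eq_intros)
    hence "((\<lambda>v. c \<bullet> (\<sigma> (k v) - q)) has_derivative G' c v) (at v)" for c
      by (auto dest!: has_derivative_inner_right[of _ _ _ c] simp: G'_def[abs_def] inner_add_right)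
    thus ?thesis unfolding f_def[abs_def] f'_def[abs_def] X_def Y_def
      by (intro has_derivative_pt2)
  qed
  have contf': "continuous_on U' (\<lambda>v. f' v w)" for w
  proof -
    have "continuous_on U' k" using contk by (rule continuous_on_subset) simp
    hence "continuous_on U' (\<lambda>v. d1 \<sigma> (k v))" "continuous_on U' (\<lambda>v. d2 \<sigma> (k v))"
      using cont_d1 cont_d2 by (auto intro: continuous_on_compose2 simp: U'_def)
    thus ?thesis unfolding f'_def G'_def by (intro continuous_intros)
  qed
  have lattice: "modeq (\<sigma> x) (q + t *\<^sub>R rvec d) \<longleftrightarrow> X x \<in> \<int> \<and> Y x \<in> \<int> \<and> (\<sigma> x - q) \<bullet> rvec e - t \<in> \<int>" for x t
    unfolding X_def Y_def by (rule modeq_line_iff[OF ab e])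
  \<comment> \<open>The half-open time interval in \<open>ipts\<close> makes t unique: it is the
    fractional part of the e-coordinate.\<close>
  have ipts_frac: "frac ((\<sigma> x - q) \<bullet> rvec e) = t" if "(x, t) \<in> ipts \<sigma> d q" for x t
    using that by (auto simp: ipts_def lattice frac_unique_iff)
  have ipts_Z: "(k v, frac ((\<sigma> (k v) - q) \<bullet> rvec e)) \<in> ipts \<sigma> d q" if "v \<in> Z" for v
  proof -
    have "y - frac y \<in> \<int>" for y :: real by (simp add: frac_def)
    thus ?thesis using that k_simplex by (auto simp: Z_def ipts_def lattice f_def frac_lt_1)
  qed
  have interior: "k v \<in> std_simplex_int \<and> D (k v) \<noteq> 0" if "v \<in> Z" for v
    using tr ipts_Z[OF that] unfolding transverse_simplex_def D_def det3_eq by fastforce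
  \<comment> \<open>Transversality puts each hit in the open simplex, whose preimage avoids all four
    sides of the square, the collapsed one included.\<close>
  have Z_int: "0 < v $ 1 \<and> v $ 1 < 1 \<and> 0 < v $ 2 \<and> v $ 2 < 1" if "v \<in> Z" for v
  proof -
    have *: "0 < v $ 1" "0 < v $ 2 * (1 - v $ 1)" "v $ 1 + v $ 2 * (1 - v $ 1) < 1"
      using interior[OF that] by (auto simp: k_def \<kappa>_def std_simplex_int_def)
    have "v $ 1 \<in> {0..1}" "v $ 2 \<in> {0..1}" using that by (auto simp: Z_def K_iff)
    moreover have "v $ 1 \<noteq> 1" using *(2) by auto
    moreover have "v $ 2 \<noteq> 1" using *(3) by auto
    ultimately show ?thesis using *(1,2) by (auto simp: zero_less_mult_iff order.order_iff_strict)
  qed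
  \<comment> \<open>This inverts the collapse away from the side r = 1.\<close>
  define k' where "k' x = pt2 (x $ 1) (x $ 2 / (1 - x $ 1))" for x :: "real^2"
  have k'k: "k' (k v) = v" if "v $ 1 < 1" for v
    using that by (simp add: k'_def k_def \<kappa>_def vec_eq_iff forall_2)
  have kk': "k (k' x) = x" if "x $ 1 < 1" for x
    using that by (simp add: k'_def k_def \<kappa>_def vec_eq_iff forall_2)
  have x_int: "0 < x $ 1 \<and> 0 < x $ 2 \<and> x $ 1 + x $ 2 < 1 \<and> D x \<noteq> 0" if "(x, t) \<in> ipts \<sigma> d q" for x t
    using tr that unfolding transverse_simplex_def D_def det3_eq std_simplex_int_def by fastforce
  have k'Z: "k' x \<in> Z" if "(x, t) \<in> ipts \<sigma> d q" for x t
  proof -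
    have x: "0 < x $ 1" "0 < x $ 2" "x $ 1 + x $ 2 < 1" using x_int[OF that] by auto
    have "k' x \<in> K" using x by (auto simp: K_iff k'_def)
    moreover have "X x \<in> \<int>" "Y x \<in> \<int>" using that by (auto simp: ipts_def lattice)
    ultimately show ?thesis using x kk'[of x] by (simp add: Z_def f_def)
  qed
  have bij: "Z = (k' \<circ> fst) ` ipts \<sigma> d q"
  proof (intro equalityI subsetI)
    fix v assume "v \<in> Z"
    thus "v \<in> (k' \<circ> fst) ` ipts \<sigma> d q"
      using ipts_Z[of v] k'k[of v] Z_int[of v] by force
  qed (use k'Z in auto)
  have finZ: "finite Z" using tr unfolding bij transverse_simplex_def by blast
  have inj: "inj_on (k' \<circ> fst) (ipts \<sigma> d q)"
  proof (rule inj_onI, clarsimp)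
    fix x t y s assume *: "(x, t) \<in> ipts \<sigma> d q" "(y, s) \<in> ipts \<sigma> d q" "k' x = k' y"
    have lt: "x $ 1 < 1" "y $ 1 < 1" using x_int[OF *(1)] x_int[OF *(2)] by auto
    have "k (k' x) = k (k' y)" by (simp only: *(3))
    hence "x = y" by (simp only: kk'[OF lt(1)] kk'[OF lt(2)])
    thus "x = y \<and> t = s" using ipts_frac * by metis
  qed
  have "(\<Sum>z\<in>Z. sgn (det (matrix (f' z)))) = (\<Sum>p\<in>ipts \<sigma> d q. sgn (det (matrix (f' (k' (fst p))))))"
    unfolding bij sum.reindex[OF inj] by simp
  also have "\<dots> = (\<Sum>p\<in>ipts \<sigma> d q. of_int (case p of (x, t) \<Rightarrow> if D x > 0 then 1 else -1))"
  proof (rule sum.cong)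
    fix p assume "p \<in> ipts \<sigma> d q"
    then obtain x t where p: "p = (x, t)" "(x, t) \<in> ipts \<sigma> d q" by (cases p) auto
    have x: "0 < x $ 1" "0 < x $ 2" "x $ 1 + x $ 2 < 1" "D x \<noteq> 0" using x_int[OF p(2)] by auto
    hence "det (matrix (f' (k' x))) = (1 - x $ 1) * D x"
      using kk'[of x] by (simp add: detf k'_def)
    moreover have "1 - x $ 1 > 0" using x by simp
    ultimately show "sgn (det (matrix (f' (k' (fst p))))) = of_int (case p of (x, t) \<Rightarrow> if D x > 0 then 1 else -1)"
      using x(4) p by (auto simp: sgn_if zero_less_mult_iff)
  qed simp
  also have "\<dots> = of_int (int_simplex \<sigma> d q)"
    by (simp add: int_simplex_def det3_eq D_def)
  finally have sum_eq: "(\<Sum>z\<in>Z. sgn (det (matrix (f' z)))) = of_int (int_simplex \<sigma> d q)" .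
  have "\<exists>e>0. \<forall>\<epsilon> (\<rho>::real\<Rightarrow>real) (B::real\<Rightarrow>real). sawtooth \<epsilon> \<rho> B \<longrightarrow> \<epsilon> \<le> e \<longrightarrow>
      integral K (\<lambda>x. \<rho> (f x $ 1) * \<rho> (f x $ 2) * det (matrix (f' x))) =
      (\<Sum>z\<in>{x \<in> K. f x $ 1 \<in> \<int> \<and> f x $ 2 \<in> \<int>}. sgn (det (matrix (f' z))))"
  proof (rule degree_integral[OF _ KU _ der contf'])
    show "open U'" unfolding U'_def using open_U contk by (rule open_vimage)
    show "{x \<in> K. f x $ 1 \<in> \<int> \<and> f x $ 2 \<in> \<int>} \<subseteq> interior K"
      using Z_int unfolding Z_def K_def interior_cbox by (auto simp: mem_box_cart forall_2)
    show "det (matrix (f' z)) \<noteq> 0" if "z \<in> {x \<in> K. f x $ 1 \<in> \<int> \<and> f x $ 2 \<in> \<int>}" for z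
      using that interior[of z] Z_int[of z] unfolding detf Z_def by auto
  qed (use finZ in \<open>auto simp: Z_def K_def\<close>)
  then obtain e0 where e0: "e0 > 0" "\<And>\<epsilon> (\<rho>::real\<Rightarrow>real) (B::real\<Rightarrow>real). sawtooth \<epsilon> \<rho> B \<Longrightarrow> \<epsilon> \<le> e0 \<Longrightarrow>
      integral K (\<lambda>x. \<rho> (f x $ 1) * \<rho> (f x $ 2) * det (matrix (f' x))) = of_int (int_simplex \<sigma> d q)"
    unfolding Z_def[symmetric] sum_eq by blast
  have "integral {0..1} (\<lambda>r. integral {0..1} (\<lambda>t. \<rho> (X (\<kappa> r t)) * \<rho> (Y (\<kappa> r t)) * ((1 - r) * D (\<kappa> r t)))) = of_int (int_simplex \<sigma> d q)"
    if saw: "sawtooth \<epsilon> \<rho> B" and le: "\<epsilon> \<le> e0" for \<epsilon> and \<rho> B :: "real \<Rightarrow> real"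
  proof -
    interpret sawtooth \<epsilon> \<rho> B by (rule saw)
    have ck: "continuous_on K k" using contk by (rule continuous_on_subset) simp
    have kU: "k ` K \<subseteq> U" using k_simplex simplex_U by auto
    have "continuous_on K (\<lambda>x. \<rho> (f x $ 1) * \<rho> (f x $ 2) * det (matrix (f' x)))"
      unfolding f_def detf X_def Y_def D_def pt2_nth
      by (intro continuous_intros continuous_on_cross continuous_on_compose2[OF cont_d1 ck kU]
          continuous_on_compose2[OF cont_d2 ck kU] continuous_on_compose2[OF cont_lift ck kU])
    hence "integral K (\<lambda>x. \<rho> (f x $ 1) * \<rho> (f x $ 2) * det (matrix (f' x))) =
      integral {0..1} (\<lambda>r. integral {0..1} (\<lambda>t. \<rho> (X (\<kappa> r t)) * \<rho> (Y (\<kappa> r t)) * ((1 - r) * D (\<kappa> r t))))"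
      unfolding K_def by (subst integral_cbox_real2) (simp_all add: f_def k_def detf)
    thus ?thesis using e0(2)[OF saw le] by simp
  qed
  thus ?thesis using e0(1) unfolding D_def by blast
qed

end

section \<open>The linking number\<close>

text \<open>Plays the part of "eventually" as \<epsilon> tends to 0: it is stable under finite
  conjunctions, and \<open>sawtooth_exists\<close> supplies a witness at every scale below
  1/4.\<close>

definition fine_sawteeth :: "((real \<Rightarrow> real) \<Rightarrow> (real \<Rightarrow> real) \<Rightarrow> bool) \<Rightarrow> bool" where
  "fine_sawteeth Q \<longleftrightarrow> (\<exists>e>0. \<forall>\<epsilon> \<rho> B. sawtooth \<epsilon> \<rho> B \<longrightarrow> \<epsilon> \<le> e \<longrightarrow> Q \<rho> B)"

lemma fine_sawteeth_ball:
  assumes "finite A" "\<And>x. x \<in> A \<Longrightarrow> fine_sawteeth (Q x)"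
  shows "fine_sawteeth (\<lambda>\<rho> B. \<forall>x\<in>A. Q x \<rho> B)"
  using assms
proof (induction A)
  case empty
  show ?case unfolding fine_sawteeth_def by (intro exI[of _ 1]) auto
next
  case (insert x A)
  have "fine_sawteeth (Q x)" "fine_sawteeth (\<lambda>\<rho> B. \<forall>x\<in>A. Q x \<rho> B)"
    using insert.IH insert.prems by auto
  then obtain e e' where "e > 0" "\<forall>\<epsilon> \<rho> B. sawtooth \<epsilon> \<rho> B \<longrightarrow> \<epsilon> \<le> e \<longrightarrow> Q x \<rho> B"
    "e' > 0" "\<forall>\<epsilon> \<rho> B. sawtooth \<epsilon> \<rho> B \<longrightarrow> \<epsilon> \<le> e' \<longrightarrow> (\<forall>x\<in>A. Q x \<rho> B)"
    unfolding fine_sawteeth_def by blast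
  thus ?case unfolding fine_sawteeth_def by (intro exI[of _ "min e e'"]) auto
qed

lemma fine_sawteeth_obtain:
  assumes "fine_sawteeth P" "fine_sawteeth Q"
  obtains \<epsilon> \<rho> B where "sawtooth \<epsilon> \<rho> B" "P \<rho> B" "Q \<rho> B"
proof -
  obtain e e' where e: "e > 0" "\<forall>\<epsilon> \<rho> B. sawtooth \<epsilon> \<rho> B \<longrightarrow> \<epsilon> \<le> e \<longrightarrow> P \<rho> B"
    "e' > 0" "\<forall>\<epsilon> \<rho> B. sawtooth \<epsilon> \<rho> B \<longrightarrow> \<epsilon> \<le> e' \<longrightarrow> Q \<rho> B"
    using assms unfolding fine_sawteeth_def by blast
  define \<epsilon> where "\<epsilon> = min (min e e') (1/8)"
  have \<epsilon>: "0 < \<epsilon>" "\<epsilon> < 1/4" "\<epsilon> \<le> e" "\<epsilon> \<le> e'" using e(1,3) by (auto simp: \<epsilon>_def)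
  obtain \<rho> B where "sawtooth \<epsilon> \<rho> B"
    using sawtooth_exists[OF \<epsilon>(1,2)] by blast
  thus ?thesis using e \<epsilon>(3,4) that by blast
qed

text \<open>The form \<open>\<alpha>\<^sub>j\<close> as a vector field.\<close>
definition linking_form ::
    "(real \<Rightarrow> real) \<Rightarrow> (real \<Rightarrow> real) \<Rightarrow> real^3 \<Rightarrow> real^3 \<Rightarrow> real^3 \<Rightarrow> real^3 \<Rightarrow> real^3" where
  "linking_form \<rho> B a b q P =
    B (a \<bullet> (P - q)) *\<^sub>R b - (\<rho> (a \<bullet> (P - q)) * B (b \<bullet> (P - q))) *\<^sub>R a"

lemma (in sawtooth) continuous_on_linking_form: "continuous_on S (linking_form \<rho> B a b q)"
  unfolding linking_form_def[abs_def] by (intro continuous_intros)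

lemma (in sawtooth) linking_form_periodic:
  assumes "int_vec k"
  shows "linking_form \<rho> B (rvec a) (rvec b) q (x + k) = linking_form \<rho> B (rvec a) (rvec b) q x"
proof -
  obtain m n where mn: "rvec a \<bullet> k = of_int m" "rvec b \<bullet> k = of_int n"
    using assms int_vec_inner int_vec_rvec by (meson Ints_cases)
  have "rvec a \<bullet> (x + k - q) = rvec a \<bullet> (x - q) + of_int m" "rvec b \<bullet> (x + k - q) = rvec b \<bullet> (x - q) + of_int n"
    by (simp_all add: inner_diff_right inner_add_right mn)
  thus ?thesis by (simp only: linking_form_def saw_plus_int bump_plus_int)
qed

section \<open>Additivity in the components, and the constant area term\<close>

lemma line_int_sum:
  assumes "finite J" and F: "\<And>j. j \<in> J \<Longrightarrow> continuous_on UNIV (F j)"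
    and g: "continuous_on {0..1} g" "continuous_on {0..1} (\<lambda>t. vector_derivative g (at t))"
  shows "line_int (\<lambda>P. \<Sum>j\<in>J. F j P) g = (\<Sum>j\<in>J. line_int (F j) g)"
  unfolding line_int_def inner_sum_left
  by (intro Henstock_Kurzweil_Integration.integral_sum integrable_continuous_interval continuous_on_inner
      continuous_on_compose2[OF F g(1)] assms) auto

text \<open>The flux of the constant field w through the simplex; for w = a \<times> b it is the
  integral of the pulled back dX \<and> dY. The factor 1 - r is the Jacobian of the
  collapse.\<close>

definition area_flux :: "(real^2 \<Rightarrow> real^3) \<Rightarrow> real^3 \<Rightarrow> real" where
  "area_flux \<sigma> w = integral {0..1} (\<lambda>r. integral {0..1} (\<lambda>t.
     (1 - r) * (cross3 (d1 \<sigma> (pt2 r (t * (1 - r)))) (d2 \<sigma> (pt2 r (t * (1 - r)))) \<bullet> w)))"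

context C1_lift begin

lemma area_flux_continuous:
  "continuous_on ({0..1} \<times> {0..1}) (\<lambda>z. (1 - fst z) *
    (cross3 (d1 \<sigma> (pt2 (fst z) (snd z * (1 - fst z)))) (d2 \<sigma> (pt2 (fst z) (snd z * (1 - fst z)))) \<bullet> w))"
  by (intro continuous_intros continuous_on_cross continuous_on_collapse cont_d1 cont_d2) auto

lemma area_flux_sum: "area_flux \<sigma> (\<Sum>j\<in>J. w j) = (\<Sum>j\<in>J. area_flux \<sigma> (w j))"
proof -
  have diff: "area_flux \<sigma> (v - w) = area_flux \<sigma> v - area_flux \<sigma> w" for v w
  proof -
    let ?A = "\<lambda>w r t. (1 - r) * (cross3 (d1 \<sigma> (pt2 r (t * (1 - r)))) (d2 \<sigma> (pt2 r (t * (1 - r)))) \<bullet> w)"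
    have "?A (v - w) r t = ?A v r t - ?A w r t" for r t :: real
      by (simp only: inner_diff_right right_diff_distrib[of "1 - r"])
    hence "area_flux \<sigma> (v - w) = integral {0..1} (\<lambda>r. integral {0..1} (\<lambda>t. ?A v r t - ?A w r t))"
      unfolding area_flux_def by presburger
    also have "\<dots> = area_flux \<sigma> v - area_flux \<sigma> w"
      unfolding area_flux_def by (rule iterated_integral_diff) (rule area_flux_continuous)+
    finally show ?thesis .
  qed
  have "Modules.additive (area_flux \<sigma>)"
  proof
    fix v w
    have "area_flux \<sigma> (v - (0 - w)) = area_flux \<sigma> v - (area_flux \<sigma> 0 - area_flux \<sigma> w)"
      by (simp only: diff)
    moreover have "area_flux \<sigma> 0 = 0" by (simp add: area_flux_def)
    ultimately show "area_flux \<sigma> (v + w) = area_flux \<sigma> v + area_flux \<sigma> w" by simp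
  qed
  thus ?thesis by (rule Modules.additive.sum)
qed

lemma edge_continuous:
  assumes "\<And>s. (u has_real_derivative u') (at s)" "\<And>s. (v has_real_derivative v') (at s)"
    and "\<And>s. s \<in> {0..1} \<Longrightarrow> pt2 (u s) (v s) \<in> U"
  shows "continuous_on {0..1} (\<lambda>t. \<sigma> (pt2 (u t) (v t)))"
    "continuous_on {0..1} (\<lambda>t. vector_derivative (\<lambda>s. \<sigma> (pt2 (u s) (v s))) (at t))"
proof -
  have "continuous_on UNIV u" "continuous_on UNIV v"
    using assms(1,2) by (meson DERIV_continuous_on has_field_derivative_at_within)+
  hence "continuous_on {0..1} u" "continuous_on {0..1} v"
    by (auto intro: continuous_on_subset)
  hence path: "continuous_on {0..1} (\<lambda>t. pt2 (u t) (v t))" by (intro continuous_intros)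
  have compose: "continuous_on {0..1} (\<lambda>t. \<phi> (pt2 (u t) (v t)))" if "continuous_on U \<phi>" for \<phi> :: "real^2 \<Rightarrow> real^3"
    using that path by (rule continuous_on_compose2) (use assms(3) in auto)
  show "continuous_on {0..1} (\<lambda>t. \<sigma> (pt2 (u t) (v t)))" by (rule compose[OF cont_lift])
  have vd: "u' *\<^sub>R d1 \<sigma> (pt2 (u t) (v t)) + v' *\<^sub>R d2 \<sigma> (pt2 (u t) (v t)) = vector_derivative (\<lambda>s. \<sigma> (pt2 (u s) (v s))) (at t)"
    if "t \<in> {0..1}" for t
    by (rule vector_derivative_at[symmetric], rule lift_path_derivative[OF assms(1,2) assms(3)[OF that]])
  have "continuous_on {0..1} (\<lambda>t. u' *\<^sub>R d1 \<sigma> (pt2 (u t) (v t)) + v' *\<^sub>R d2 \<sigma> (pt2 (u t) (v t)))"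
    by (intro continuous_intros compose cont_d1 cont_d2)
  thus "continuous_on {0..1} (\<lambda>t. vector_derivative (\<lambda>s. \<sigma> (pt2 (u s) (v s))) (at t))"
    by (rule continuous_on_eq) (rule vd)
qed

lemma boundary_int_sum:
  assumes J: "finite J" and F: "\<And>j. j \<in> J \<Longrightarrow> continuous_on UNIV (F j)"
  shows "boundary_int (\<lambda>P. \<Sum>j\<in>J. F j P) \<sigma> = (\<Sum>j\<in>J. boundary_int (F j) \<sigma>)"
proof -
  have d: "((\<lambda>t. t) has_real_derivative 1) (at s)" "((\<lambda>t. 1 - t) has_real_derivative - 1) (at s)"
    "((\<lambda>t. 0) has_real_derivative 0) (at s)" for s :: real
    by (auto intro!: derivative_eq_intros)
  have U: "pt2 s 0 \<in> U" "pt2 (1 - s) s \<in> U" "pt2 0 (1 - s) \<in> U" if "s \<in> {0..1}" for s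
    using collapse_in_U[of s 0] collapse_in_U[of "1 - s" 1] collapse_in_U[of 0 "1 - s"] that by simp_all
  have "line_int (\<lambda>P. \<Sum>j\<in>J. F j P) (\<lambda>t. \<sigma> (pt2 t 0)) = (\<Sum>j\<in>J. line_int (F j) (\<lambda>t. \<sigma> (pt2 t 0)))"
    by (rule line_int_sum[OF J F edge_continuous[OF d(1) d(3) U(1)]])
  moreover have "line_int (\<lambda>P. \<Sum>j\<in>J. F j P) (\<lambda>t. \<sigma> (pt2 (1 - t) t)) = (\<Sum>j\<in>J. line_int (F j) (\<lambda>t. \<sigma> (pt2 (1 - t) t)))"
    by (rule line_int_sum[OF J F edge_continuous[OF d(2) d(1) U(2)]])
  moreover have "line_int (\<lambda>P. \<Sum>j\<in>J. F j P) (\<lambda>t. \<sigma> (pt2 0 (1 - t))) = (\<Sum>j\<in>J. line_int (F j) (\<lambda>t. \<sigma> (pt2 0 (1 - t))))"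
    by (rule line_int_sum[OF J F edge_continuous[OF d(3) d(2) U(3)]])
  ultimately show ?thesis by (simp add: boundary_int_def sum.distrib)
qed

text \<open>Stokes yields the density \<rho>(X) \<rho>(Y) - 1. Its first part integrates to exactly
  the signed count for small \<epsilon>, and its second part does not involve the sawtooth at
  all.\<close>

lemma simplex_stokes:
  assumes ab: "cross3 (rvec a) (rvec b) = rvec d" and e: "rvec d \<bullet> rvec e = 1"
    and tr: "transverse_simplex \<sigma> d q"
  shows "fine_sawteeth (\<lambda>\<rho> B. boundary_int (linking_form \<rho> B (rvec a) (rvec b) q) \<sigma> =
    of_int (int_simplex \<sigma> d q) - area_flux \<sigma> (rvec d))"
proof -
  let ?\<kappa> = "\<lambda>r t :: real. pt2 r (t * (1 - r))"
  let ?X = "\<lambda>x. rvec a \<bullet> (\<sigma> x - q)" and ?Y = "\<lambda>x. rvec b \<bullet> (\<sigma> x - q)"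
  let ?J = "\<lambda>r t. (1 - r) * (cross3 (d1 \<sigma> (?\<kappa> r t)) (d2 \<sigma> (?\<kappa> r t)) \<bullet> rvec d)"
  have eq: "boundary_int (linking_form \<rho> B (rvec a) (rvec b) q) \<sigma> =
      integral {0..1} (\<lambda>r. integral {0..1} (\<lambda>t. \<rho> (?X (?\<kappa> r t)) * \<rho> (?Y (?\<kappa> r t)) * ?J r t)) - area_flux \<sigma> (rvec d)"
    if saw: "sawtooth \<epsilon> \<rho> B" for \<epsilon> \<rho> B
  proof -
    interpret sawtooth \<epsilon> \<rho> B by (rule saw)
    have "boundary_int (linking_form \<rho> B (rvec a) (rvec b) q) \<sigma> =
        integral {0..1} (\<lambda>r. integral {0..1} (\<lambda>t. (\<rho> (?X (?\<kappa> r t)) * \<rho> (?Y (?\<kappa> r t)) - 1) * ?J r t))"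
      unfolding linking_form_def[abs_def] using boundary_int_eq[OF saw, of "rvec a" q "rvec b"] by (simp only: ab)
    also have "\<dots> = integral {0..1} (\<lambda>r. integral {0..1} (\<lambda>t. \<rho> (?X (?\<kappa> r t)) * \<rho> (?Y (?\<kappa> r t)) * ?J r t - ?J r t))"
      by (simp only: left_diff_distrib mult_1_left)
    also have "\<dots> = integral {0..1} (\<lambda>r. integral {0..1} (\<lambda>t. \<rho> (?X (?\<kappa> r t)) * \<rho> (?Y (?\<kappa> r t)) * ?J r t)) - area_flux \<sigma> (rvec d)"
      unfolding area_flux_def
      by (intro iterated_integral_diff continuous_intros continuous_on_cross continuous_on_collapse cont_lift cont_d1 cont_d2) auto
    finally show ?thesis .
  qed
  show ?thesis
    unfolding fine_sawteeth_def
  proof -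
    obtain e0 where e0: "e0 > 0" "\<And>\<epsilon> \<rho> B. sawtooth \<epsilon> \<rho> B \<Longrightarrow> \<epsilon> \<le> e0 \<Longrightarrow>
      integral {0..1} (\<lambda>r. integral {0..1} (\<lambda>t. \<rho> (?X (?\<kappa> r t)) * \<rho> (?Y (?\<kappa> r t)) * ?J r t)) = of_int (int_simplex \<sigma> d q)"
      using simplex_degree[OF assms] by blast
    show "\<exists>e>0. \<forall>\<epsilon> \<rho> B. sawtooth \<epsilon> \<rho> B \<longrightarrow> \<epsilon> \<le> e \<longrightarrow>
      boundary_int (linking_form \<rho> B (rvec a) (rvec b) q) \<sigma> = of_int (int_simplex \<sigma> d q) - area_flux \<sigma> (rvec d)"
    proof (intro exI[of _ e0] conjI allI impI)
      fix \<epsilon> \<rho> B assume saw: "sawtooth \<epsilon> \<rho> B" and le: "\<epsilon> \<le> e0"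
      show "boundary_int (linking_form \<rho> B (rvec a) (rvec b) q) \<sigma> = of_int (int_simplex \<sigma> d q) - area_flux \<sigma> (rvec d)"
        by (simp only: eq[OF saw] e0(2)[OF saw le])
    qed (rule e0(1))
  qed
qed

end

text \<open>Since c \<times> d = n a - m b with m and n the slopes of X and Y along c, vanishing
  slopes mean collinear classes, and then the form annihilates the velocity. Otherwise the planar
  computation applies with g the gcd of m and n.\<close>

lemma geodesic_line_int:
  assumes ab: "cross3 (rvec a) (rvec b) = rvec d" and e: "rvec d \<bullet> rvec e = 1"
    and disj: "geod_pts c p \<inter> geod_pts d q = {}"
  shows "fine_sawteeth (\<lambda>\<rho> B. line_int (linking_form \<rho> B (rvec a) (rvec b) q) (\<lambda>t. p + t *\<^sub>R rvec c) =
    (if collinear {0, rvec c, rvec d} then 0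
       else det3 (rvec c) (rvec d) ((1 / norm (rvec (beta c d))) *\<^sub>R rvec (beta c d))
            * (1 - 2 * frac ((p - q) \<bullet> rvec (beta c d)))
            / (2 * norm (rvec (beta c d)))))"
proof -
  obtain m n where mn: "rvec a \<bullet> rvec c = of_int m" "rvec b \<bullet> rvec c = of_int n"
    by (meson Ints_cases inner_rvec_Ints)
  define x where "x = rvec a \<bullet> (p - q)"
  define y where "y = rvec b \<bullet> (p - q)"
  have li: "line_int (linking_form \<rho> B (rvec a) (rvec b) q) (\<lambda>t. p + t *\<^sub>R rvec c) =
      integral {0..1} (\<lambda>t. n * B (x + t * m) - m * \<rho> (x + t * m) * B (y + t * n))" for \<rho> B :: "real \<Rightarrow> real"
    unfolding line_int_def
  proof (rule integral_cong)
    fix t :: real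
    have "((\<lambda>t. p + t *\<^sub>R rvec c) has_vector_derivative rvec c) (at t)"
      by (auto intro!: derivative_eq_intros)
    hence vd: "vector_derivative (\<lambda>t. p + t *\<^sub>R rvec c) (at t) = rvec c"
      by (rule vector_derivative_at)
    have "rvec a \<bullet> (p + t *\<^sub>R rvec c - q) = x + t * m" "rvec b \<bullet> (p + t *\<^sub>R rvec c - q) = y + t * n"
      by (simp_all add: x_def y_def inner_add_right inner_diff_right mn)
    thus "linking_form \<rho> B (rvec a) (rvec b) q (p + t *\<^sub>R rvec c) \<bullet> vector_derivative (\<lambda>t. p + t *\<^sub>R rvec c) (at t) =
      n * B (x + t * m) - m * \<rho> (x + t * m) * B (y + t * n)"
      by (simp add: vd linking_form_def inner_diff_left mn)
  qed
  have cd: "cross3 (rvec c) (rvec d) = n *\<^sub>R rvec a - m *\<^sub>R rvec b"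
    using cross3_of_projections[OF ab, of "rvec c"] by (simp add: mn)
  show ?thesis
  proof (cases "m = 0 \<and> n = 0")
    case True
    hence "collinear {0, rvec c, rvec d}" using cd by (simp add: cross_eq_0[symmetric])
    thus ?thesis unfolding fine_sawteeth_def li using True by (intro exI[of _ 1]) simp
  next
    case False
    define g where "g = gcd m n"
    have g: "g > 0" using False by (auto simp: g_def)
    define m' n' where "m' = m div g" and "n' = n div g"
    have gmn: "m = g * m'" "n = g * n'" by (simp_all add: m'_def n'_def g_def)
    have cop: "coprime m' n'" using False unfolding m'_def n'_def g_def by (intro div_gcd_coprime) auto
    note bf = beta_formula[OF ab e mn gmn g cop]
    have ncol: "\<not> collinear {0, rvec c, rvec d}"
      using bf(2,3) g by (simp add: cross_eq_0[symmetric])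
    \<comment> \<open>Integer values of X and Y at the same time would put a point of the first
      geodesic on the second; taking fractional parts brings both times into the unit
      interval.\<close>
    have avoid: "x + t * m \<notin> \<int> \<or> y + t * n \<notin> \<int>" for t :: real
    proof (rule ccontr)
      assume *: "\<not> ?thesis"
      define P where "P = p + t *\<^sub>R rvec c"
      have "rvec a \<bullet> (P - q) = x + t * m" "rvec b \<bullet> (P - q) = y + t * n"
        by (simp_all add: P_def x_def y_def inner_add_right inner_diff_right mn)
      moreover have frac_int: "z - frac z \<in> \<int>" for z :: real by (simp add: frac_def)
      ultimately have "modeq P (q + frac ((P - q) \<bullet> rvec e) *\<^sub>R rvec d)"
        using * by (simp add: modeq_line_iff[OF ab e])
      hence "P \<in> geod_pts d q"
        unfolding geod_pts_def using frac_lt_1[of "(P - q) \<bullet> rvec e"] by (force intro!: bexI[of _ "frac ((P - q) \<bullet> rvec e)"])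
      moreover have "modeq P (p + frac t *\<^sub>R rvec c)"
      proof -
        have "P - (p + frac t *\<^sub>R rvec c) = (t - frac t) *\<^sub>R rvec c" by (simp add: P_def algebra_simps)
        thus ?thesis unfolding modeq_def using int_vec_scaleR[OF frac_int int_vec_rvec] by simp
      qed
      hence "P \<in> geod_pts c p"
        unfolding geod_pts_def using frac_lt_1[of t] by (force intro!: bexI[of _ "frac t"])
      ultimately show False using disj by auto
    qed
    define \<beta> where "\<beta> = rvec (beta c d)"
    have "(p - q) \<bullet> \<beta> = n' * x - m' * y"
      unfolding \<beta>_def bf(1) by (simp add: x_def y_def inner_diff_right inner_commute)
    \<comment> \<open>Since c \<times> d = g \<beta>, the determinant is g times the norm of
      \<beta>. Dividing by twice that norm leaves g / 2.\<close>
    moreover have "det3 (rvec c) (rvec d) ((1 / norm \<beta>) *\<^sub>R \<beta>) * (1 - 2 * frac ((p - q) \<bullet> \<beta>)) / (2 * norm \<beta>) =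
      g * (1/2 - frac ((p - q) \<bullet> \<beta>))"
    proof -
      have "norm \<beta> \<noteq> 0" using bf(3) by (simp add: \<beta>_def)
      moreover have "\<beta> \<bullet> \<beta> = norm \<beta> * norm \<beta>" by (simp add: dot_square_norm power2_eq_square)
      ultimately show ?thesis
        by (simp add: det3_eq bf(2) \<beta>_def[symmetric] field_simps)
    qed
    ultimately have "(if collinear {0, rvec c, rvec d} then 0
       else det3 (rvec c) (rvec d) ((1 / norm (rvec (beta c d))) *\<^sub>R rvec (beta c d))
            * (1 - 2 * frac ((p - q) \<bullet> rvec (beta c d)))
            / (2 * norm (rvec (beta c d)))) = g * (1/2 - frac (n' * x - m' * y))"
      using ncol by (simp add: \<beta>_def)
    thus ?thesis using geodesic_integral[OF gmn g cop avoid]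
      unfolding fine_sawteeth_def li by simp
  qed
qed

theorem theorem5:
  fixes I :: "'i set" and c :: "'i \<Rightarrow> int^3" and p :: "'i \<Rightarrow> real^3"
    and J :: "'j set" and d :: "'j \<Rightarrow> int^3" and q :: "'j \<Rightarrow> real^3"
    and S :: "(int \<times> (real^2 \<Rightarrow> real^3)) list"
  assumes "multi_geodesic I c p" and "homologically_trivial I c"
    and "multi_geodesic J d q" and "homologically_trivial J d"
    and "disjoint_multi I c p J d q"
    and "bounds S I c p" and "transverse S J d q"
  shows "real_of_int (intersection_number S J d q) =
    (\<Sum>(i, j)\<in>I \<times> J.
       if collinear {0, rvec (c i), rvec (d j)} then 0
       else det3 (rvec (c i)) (rvec (d j)) ((1 / norm (rvec (beta (c i) (d j)))) *\<^sub>R rvec (beta (c i) (d j)))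
            * (1 - 2 * frac ((p i - q j) \<bullet> rvec (beta (c i) (d j))))
            / (2 * norm (rvec (beta (c i) (d j)))))"
proof -
  define contrib where "contrib i j = (if collinear {0, rvec (c i), rvec (d j)} then 0
       else det3 (rvec (c i)) (rvec (d j)) ((1 / norm (rvec (beta (c i) (d j)))) *\<^sub>R rvec (beta (c i) (d j)))
            * (1 - 2 * frac ((p i - q j) \<bullet> rvec (beta (c i) (d j))))
            / (2 * norm (rvec (beta (c i) (d j)))))" for i j
  have fin: "finite I" "finite J" using assms(1,3) by (auto simp: multi_geodesic_def)
  have "\<exists>a b e. cross3 (rvec a) (rvec b) = rvec (d j) \<and> rvec (d j) \<bullet> rvec e = 1" if "j \<in> J" for j
    using primitive_basis[of "d j"] assms(3) that unfolding multi_geodesic_def by metis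
  then obtain a b e where ab: "\<And>j. j \<in> J \<Longrightarrow> cross3 (rvec (a j)) (rvec (b j)) = rvec (d j)"
    and e: "\<And>j. j \<in> J \<Longrightarrow> rvec (d j) \<bullet> rvec (e j) = 1"
    by metis
  have lift: "\<exists>U. C1_lift \<sigma> U" if "(n, \<sigma>) \<in> set S" for n \<sigma>
  proof -
    have "C1_simplex \<sigma>" using assms(6) that unfolding bounds_def by blast
    thus ?thesis unfolding C1_simplex_def C1_lift_def by blast
  qed
  have fine_S: "fine_sawteeth (\<lambda>\<rho> B. \<forall>z\<in>set S \<times> J. boundary_int (linking_form \<rho> B (rvec (a (snd z))) (rvec (b (snd z))) (q (snd z))) (snd (fst z)) =
    of_int (int_simplex (snd (fst z)) (d (snd z)) (q (snd z))) - area_flux (snd (fst z)) (rvec (d (snd z))))"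
  proof (rule fine_sawteeth_ball)
    fix z assume "z \<in> set S \<times> J"
    then obtain n \<sigma> j where z: "z = ((n, \<sigma>), j)" "(n, \<sigma>) \<in> set S" "j \<in> J" by (cases z) auto
    obtain U where "C1_lift \<sigma> U" using lift[OF z(2)] by blast
    moreover have "transverse_simplex \<sigma> (d j) (q j)" using assms(7) z unfolding transverse_def by blast
    ultimately show "fine_sawteeth (\<lambda>\<rho> B. boundary_int (linking_form \<rho> B (rvec (a (snd z))) (rvec (b (snd z))) (q (snd z))) (snd (fst z)) =
      of_int (int_simplex (snd (fst z)) (d (snd z)) (q (snd z))) - area_flux (snd (fst z)) (rvec (d (snd z))))"
      using C1_lift.simplex_stokes[OF _ ab e] z by simp
  qed (use fin in simp)
  have fine_I: "fine_sawteeth (\<lambda>\<rho> B. \<forall>z\<in>I \<times> J.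
    line_int (linking_form \<rho> B (rvec (a (snd z))) (rvec (b (snd z))) (q (snd z))) (\<lambda>t. p (fst z) + t *\<^sub>R rvec (c (fst z))) = contrib (fst z) (snd z))"
  proof (rule fine_sawteeth_ball)
    fix z assume "z \<in> I \<times> J"
    then obtain i j where z: "z = (i, j)" "i \<in> I" "j \<in> J" by auto
    have "geod_pts (c i) (p i) \<inter> geod_pts (d j) (q j) = {}" using assms(5) z unfolding disjoint_multi_def by blast
    hence "fine_sawteeth (\<lambda>\<rho> B. line_int (linking_form \<rho> B (rvec (a j)) (rvec (b j)) (q j)) (\<lambda>t. p i + t *\<^sub>R rvec (c i)) = contrib i j)"
      unfolding contrib_def by (rule geodesic_line_int[OF ab[OF z(3)] e[OF z(3)]])
    thus "fine_sawteeth (\<lambda>\<rho> B. line_int (linking_form \<rho> B (rvec (a (snd z))) (rvec (b (snd z))) (q (snd z))) (\<lambda>t. p (fst z) + t *\<^sub>R rvec (c (fst z))) = contrib (fst z) (snd z))"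
      by (simp add: z(1))
  qed (use fin in simp)
  \<comment> \<open>One sawtooth is fine enough for all the finitely many pairs, and from here on
    every identity is exact.\<close>
  obtain \<epsilon> \<rho> B where saw: "sawtooth \<epsilon> \<rho> B"
    and simplex': "\<forall>z\<in>set S \<times> J. boundary_int (linking_form \<rho> B (rvec (a (snd z))) (rvec (b (snd z))) (q (snd z))) (snd (fst z)) =
    of_int (int_simplex (snd (fst z)) (d (snd z)) (q (snd z))) - area_flux (snd (fst z)) (rvec (d (snd z)))"
    and geod': "\<forall>z\<in>I \<times> J. line_int (linking_form \<rho> B (rvec (a (snd z))) (rvec (b (snd z))) (q (snd z))) (\<lambda>t. p (fst z) + t *\<^sub>R rvec (c (fst z))) = contrib (fst z) (snd z)"
    by (rule fine_sawteeth_obtain[OF fine_S fine_I])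
  interpret sawtooth \<epsilon> \<rho> B by (rule saw)
  define F where "F j = linking_form \<rho> B (rvec (a j)) (rvec (b j)) (q j)" for j
  define G where "G P = (\<Sum>j\<in>J. F j P)" for P
  have contF: "continuous_on UNIV (F j)" for j unfolding F_def by (rule continuous_on_linking_form)
  have contG: "continuous_on UNIV G" unfolding G_def[abs_def] using contF by (intro continuous_on_sum)
  \<comment> \<open>Integrality of the vectors a and b lets the form descend to the torus, so that
    \<open>bounds\<close> may be tested on it.\<close>
  have perG: "periodic3 G"
    unfolding periodic3_def G_def F_def using linking_form_periodic by (auto intro!: sum.cong)
  have "(\<Sum>(n, \<sigma>)\<leftarrow>S. real_of_int n * boundary_int G \<sigma>) = (\<Sum>i\<in>I. line_int G (\<lambda>t. p i + t *\<^sub>R rvec (c i)))"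
    using assms(6) contG perG unfolding bounds_def by blast
  also have "\<dots> = (\<Sum>i\<in>I. \<Sum>j\<in>J. contrib i j)"
  proof (rule sum.cong)
    fix i assume i: "i \<in> I"
    have vd: "vector_derivative (\<lambda>t. p i + t *\<^sub>R rvec (c i)) (at t) = rvec (c i)" for t
      by (rule vector_derivative_at) (auto intro!: derivative_eq_intros)
    have "line_int G (\<lambda>t. p i + t *\<^sub>R rvec (c i)) = (\<Sum>j\<in>J. line_int (F j) (\<lambda>t. p i + t *\<^sub>R rvec (c i)))"
      unfolding G_def[abs_def] by (intro line_int_sum fin contF) (simp_all only: vd continuous_on_const, intro continuous_intros)
    also have "\<dots> = (\<Sum>j\<in>J. contrib i j)" using geod' i by (intro sum.cong) (auto simp: F_def)
    finally show "line_int G (\<lambda>t. p i + t *\<^sub>R rvec (c i)) = (\<Sum>j\<in>J. contrib i j)" .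
  qed simp
  also have "\<dots> = (\<Sum>(i, j)\<in>I \<times> J. contrib i j)" by (rule sum.cartesian_product)
  finally have main: "(\<Sum>(n, \<sigma>)\<leftarrow>S. real_of_int n * boundary_int G \<sigma>) = (\<Sum>(i, j)\<in>I \<times> J. contrib i j)" .
  \<comment> \<open>By additivity of the flux, the area terms cancel on each simplex separately,
    before the chain is summed.\<close>
  have bd: "boundary_int G \<sigma> = of_int (\<Sum>j\<in>J. int_simplex \<sigma> (d j) (q j))" if S: "(n, \<sigma>) \<in> set S" for n \<sigma>
  proof -
    obtain U where U: "C1_lift \<sigma> U" using lift[OF S] by blast
    have "boundary_int G \<sigma> = (\<Sum>j\<in>J. boundary_int (F j) \<sigma>)"
      unfolding G_def[abs_def] using contF by (intro C1_lift.boundary_int_sum[OF U] fin)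
    also have "\<dots> = (\<Sum>j\<in>J. of_int (int_simplex \<sigma> (d j) (q j)) - area_flux \<sigma> (rvec (d j)))"
      using simplex' S by (intro sum.cong) (force simp: F_def)+
    also have "\<dots> = of_int (\<Sum>j\<in>J. int_simplex \<sigma> (d j) (q j)) - area_flux \<sigma> (rvec (\<Sum>j\<in>J. d j))"
      by (simp add: sum_subtractf rvec_sum C1_lift.area_flux_sum[OF U])
    also have "rvec (\<Sum>j\<in>J. d j) = 0" using assms(4) by (simp add: homologically_trivial_def)
    also have "area_flux \<sigma> 0 = 0" by (simp add: area_flux_def)
    finally show ?thesis by simp
  qed
  have "real_of_int (intersection_number S J d q) = (\<Sum>(n, \<sigma>)\<leftarrow>S. real_of_int n * of_int (\<Sum>j\<in>J. int_simplex \<sigma> (d j) (q j)))"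
    unfolding intersection_number_def by (induction S) auto
  also have "\<dots> = (\<Sum>(n, \<sigma>)\<leftarrow>S. real_of_int n * boundary_int G \<sigma>)"
    using bd by (intro arg_cong[of _ _ sum_list] map_cong) auto
  finally show ?thesis unfolding main contrib_def .
qed

end
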